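(* Let $d\ge 3$ be an integer. For every connected finite simple graph $G$ on at least $3$ vertices with minimum degree at least $d$, $$\min_{\lambda\in\sigma(\mathbf{L})}|\lambda-1|\le \frac{\sqrt{d-1}}{d},$$ with equality if and only if $G$ is the incidence graph of a finite projective plane of order $d-1$.
   Context: For a graph $G$ with adjacency matrix $\mathbf{A}$ and degree matrix $\mathbf{D}=\mathrm{diag}(\deg v_1,\dots,\deg v_N)$, the normalized Laplacian is $\mathbf{L}=\mathbf{I}-\mathbf{D}^{-1}\mathbf{A}$, i.e. $\mathbf{L}f(v)=f(v)-\frac{1}{\deg v}\sum_{w\sim v}f(w)$; $\sigma(\mathbf{L})$ is its spectrum. A finite projective plane of order $n\ge 2$ is an incidence structure consisting of a finite set $P$ of points, a finite set $\mathcal{L}$ of lines and an incidence relation such that: every two distinct points are incident with a unique common line; every two distinct lines are incident with a unique common point; there exist four points no three of which are collinear; and some line is incident with exactly $n+1$ points. Its incidence graph is the bipartite graph on $P\sqcup\mathcal{L}$ in which $p$ and $\ell$ are adjacent iff $p$ is incident with $\ell$. *)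

theory Defs
  imports
    "Graph_Theory.Graph_Theory"
    "Jordan_Normal_Form.Spectral_Radius"
begin

text \<open>
  A finite simple graph is a \<open>pair_graph\<close>: a finite, symmetric, loop-free set of pairs. The degree
  of a vertex is its \<open>out_degree\<close>, which by symmetry is the number of its neighbours.
  Matrices are taken with respect to an enumeration \<open>vs\<close> of the vertices without repetition.
\<close>

definition adjacency_matrix :: "'a pair_pre_digraph \<Rightarrow> 'a list \<Rightarrow> complex mat" where
  "adjacency_matrix G vs =
     mat (length vs) (length vs) (\<lambda>(i, j). if (vs ! i, vs ! j) \<in> parcs G then 1 else 0)"

definition degree_matrix :: "'a pair_pre_digraph \<Rightarrow> 'a list \<Rightarrow> complex mat" where
  "degree_matrix G vs = mat_diag (length vs) (\<lambda>i. of_nat (out_degree G (vs ! i)))"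

definition degree_matrix_inv :: "'a pair_pre_digraph \<Rightarrow> 'a list \<Rightarrow> complex mat" where
  "degree_matrix_inv G vs = mat_diag (length vs) (\<lambda>i. 1 / of_nat (out_degree G (vs ! i)))"

lemma degree_matrix_inv:
  fixes G :: "'a pair_pre_digraph"
  assumes "\<And>v. v \<in> set vs \<Longrightarrow> out_degree G v > 0"
  shows "inverts_mat (degree_matrix G vs) (degree_matrix_inv G vs)"
    and "inverts_mat (degree_matrix_inv G vs) (degree_matrix G vs)"
proof -
  have nz: "out_degree G (vs ! i) \<noteq> 0" if "i < length vs" for i
    using assms[of "vs ! i"] that by simp
  show "inverts_mat (degree_matrix G vs) (degree_matrix_inv G vs)"
    and "inverts_mat (degree_matrix_inv G vs) (degree_matrix G vs)"
    unfolding inverts_mat_def degree_matrix_def degree_matrix_inv_def mat_diag_diag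
    by (auto simp: mat_diag_def nz intro!: eq_matI)
qed

definition normalized_laplacian :: "'a pair_pre_digraph \<Rightarrow> 'a list \<Rightarrow> complex mat" where
  "normalized_laplacian G vs =
     1\<^sub>m (length vs) - degree_matrix_inv G vs * adjacency_matrix G vs"

lemma normalized_laplacian_mult_vec:
  assumes G: "pair_graph G" and vs: "distinct vs" "set vs = pverts G" and i: "i < length vs"
  shows "(normalized_laplacian G vs *\<^sub>v vec (length vs) (\<lambda>j. f (vs ! j))) $ i =
    f (vs ! i) - 1 / of_nat (out_degree G (vs ! i)) * (\<Sum>w | (vs ! i, w) \<in> parcs G. f w)"
proof -
  interpret pair_graph G by (fact G)
  let ?n = "length vs" and ?d = "of_nat (out_degree G (vs ! i)) :: complex"
  have bij: "bij_betw (\<lambda>j. vs ! j) {0..<?n} (pverts G)"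
    using bij_betw_nth[OF vs(1)] vs(2) by (simp add: atLeast0LessThan)
  have L: "normalized_laplacian G vs = mat ?n ?n (\<lambda>(k, j). (if k = j then 1 else 0)
      - 1 / of_nat (out_degree G (vs ! k)) * (if (vs ! k, vs ! j) \<in> parcs G then 1 else 0))"
    unfolding normalized_laplacian_def degree_matrix_inv_def
    by (subst mat_diag_mult_left[where nr = ?n])
      (auto simp: adjacency_matrix_def intro!: eq_matI)
  have "(normalized_laplacian G vs *\<^sub>v vec ?n (\<lambda>j. f (vs ! j))) $ i =
      (\<Sum>j = 0..<?n. ((if i = j then 1 else 0)
        - 1 / ?d * (if (vs ! i, vs ! j) \<in> parcs G then 1 else 0)) * f (vs ! j))"
    using i unfolding L by (auto simp: scalar_prod_def intro!: sum.cong)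
  also have "\<dots> = (\<Sum>j = 0..<?n. (if i = j then f (vs ! j) else 0)
        - 1 / ?d * (if (vs ! i, vs ! j) \<in> parcs G then f (vs ! j) else 0))"
    by (rule sum.cong) (auto simp: algebra_simps)
  also have "\<dots> = f (vs ! i) -
      1 / ?d * (\<Sum>j = 0..<?n. if (vs ! i, vs ! j) \<in> parcs G then f (vs ! j) else 0)"
    using i by (simp add: sum_subtractf sum_distrib_left)
  also have "(\<Sum>j = 0..<?n. if (vs ! i, vs ! j) \<in> parcs G then f (vs ! j) else 0) =
      (\<Sum>w\<in>pverts G. if (vs ! i, w) \<in> parcs G then f w else 0)"
    by (rule sum.reindex_bij_betw[OF bij])
  also have "\<dots> = (\<Sum>w | (vs ! i, w) \<in> parcs G. f w)"
    by (rule sum.mono_neutral_cong_right) (auto simp: pair_finite_verts dest: in_arcsD2)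
  finally show ?thesis .
qed

definition finite_projective_plane ::
    "'p set \<Rightarrow> 'l set \<Rightarrow> ('p \<Rightarrow> 'l \<Rightarrow> bool) \<Rightarrow> nat \<Rightarrow> bool" where
  "finite_projective_plane P L inc n \<longleftrightarrow>
     n \<ge> 2 \<and> finite P \<and> finite L \<and>
     (\<forall>p\<in>P. \<forall>q\<in>P. p \<noteq> q \<longrightarrow> (\<exists>!l. l \<in> L \<and> inc p l \<and> inc q l)) \<and>
     (\<forall>l\<in>L. \<forall>m\<in>L. l \<noteq> m \<longrightarrow> (\<exists>!p. p \<in> P \<and> inc p l \<and> inc p m)) \<and>
     (\<exists>S\<subseteq>P. card S = 4 \<and> (\<forall>T\<subseteq>S. card T = 3 \<longrightarrow> \<not> (\<exists>l\<in>L. \<forall>p\<in>T. inc p l))) \<and>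
     (\<exists>l\<in>L. card {p \<in> P. inc p l} = n + 1)"

definition incidence_graph ::
    "'p set \<Rightarrow> 'l set \<Rightarrow> ('p \<Rightarrow> 'l \<Rightarrow> bool) \<Rightarrow> ('p + 'l) pair_pre_digraph" where
  "incidence_graph P L inc =
     \<lparr> pverts = P <+> L,
       parcs = {(Inl p, Inr l) | p l. p \<in> P \<and> l \<in> L \<and> inc p l}
             \<union> {(Inr l, Inl p) | p l. p \<in> P \<and> l \<in> L \<and> inc p l} \<rparr>"

text \<open>
  The existential quantifier ranges over planes whose points and lines are natural numbers. Since
  planes are finite and graphs are compared up to isomorphism, this is no restriction; see
  \<open>is_plane_incidence_graphI\<close> below.
\<close>

definition is_plane_incidence_graph :: "'a pair_pre_digraph \<Rightarrow> nat \<Rightarrow> bool" where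
  "is_plane_incidence_graph G n \<longleftrightarrow>
     (\<exists>(P :: nat set) (L :: nat set) inc.
        finite_projective_plane P L inc n \<and> digraph_iso G (incidence_graph P L inc))"

lemma finite_projective_plane_transfer:
  assumes pl: "finite_projective_plane P L inc n"
    and f: "bij_betw f P P'" and g: "bij_betw g L L'"
    and inc: "\<And>p l. p \<in> P \<Longrightarrow> l \<in> L \<Longrightarrow> inc' (f p) (g l) \<longleftrightarrow> inc p l"
  shows "finite_projective_plane P' L' inc' n"
proof -
  have P': "P' = f ` P" and L': "L' = g ` L" and fi: "inj_on f P" and gi: "inj_on g L"
    using f g by (auto simp: bij_betw_def)
  have ax1: "\<forall>p\<in>P. \<forall>q\<in>P. p \<noteq> q \<longrightarrow> (\<exists>!l. l \<in> L \<and> inc p l \<and> inc q l)"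
    and ax2: "\<forall>l\<in>L. \<forall>m\<in>L. l \<noteq> m \<longrightarrow> (\<exists>!p. p \<in> P \<and> inc p l \<and> inc p m)"
    and ax3: "\<exists>S\<subseteq>P. card S = 4 \<and> (\<forall>T\<subseteq>S. card T = 3 \<longrightarrow> \<not> (\<exists>l\<in>L. \<forall>p\<in>T. inc p l))"
    and ax4: "\<exists>l\<in>L. card {p \<in> P. inc p l} = n + 1"
    and ax5: "n \<ge> 2" "finite P" "finite L"
    using pl unfolding finite_projective_plane_def by - (elim conjE, assumption)+
  have b1: "\<exists>!l. l \<in> L' \<and> inc' p l \<and> inc' q l" if pq: "p \<in> P'" "q \<in> P'" "p \<noteq> q" for p q
  proof -
    obtain p0 q0 where *: "p0 \<in> P" "q0 \<in> P" "p = f p0" "q = f q0" "p0 \<noteq> q0"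
      using pq P' by blast
    have "\<exists>!l. l \<in> L \<and> inc p0 l \<and> inc q0 l" by (rule ax1[rule_format]) fact+
    then obtain l where l: "l \<in> L" "inc p0 l" "inc q0 l"
      and u: "\<And>m. m \<in> L \<Longrightarrow> inc p0 m \<Longrightarrow> inc q0 m \<Longrightarrow> m = l" by blast
    show ?thesis
    proof (rule ex1I[of _ "g l"])
      show "g l \<in> L' \<and> inc' p (g l) \<and> inc' q (g l)"
        using * l L' by (simp add: inc)
    next
      fix m assume m: "m \<in> L' \<and> inc' p m \<and> inc' q m"
      then obtain m0 where m0: "m0 \<in> L" "m = g m0" using L' by blast
      then have "inc p0 m0" "inc q0 m0" using m * inc by blast+
      then show "m = g l" using u m0 by simp
    qed
  qed
  have b2: "\<exists>!p. p \<in> P' \<and> inc' p l \<and> inc' p m" if lm: "l \<in> L'" "m \<in> L'" "l \<noteq> m" for l m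
  proof -
    obtain l0 m0 where *: "l0 \<in> L" "m0 \<in> L" "l = g l0" "m = g m0" "l0 \<noteq> m0"
      using lm L' by blast
    have "\<exists>!p. p \<in> P \<and> inc p l0 \<and> inc p m0" by (rule ax2[rule_format]) fact+
    then obtain p where p: "p \<in> P" "inc p l0" "inc p m0"
      and u: "\<And>q. q \<in> P \<Longrightarrow> inc q l0 \<Longrightarrow> inc q m0 \<Longrightarrow> q = p" by blast
    show ?thesis
    proof (rule ex1I[of _ "f p"])
      show "f p \<in> P' \<and> inc' (f p) l \<and> inc' (f p) m"
        using * p P' by (simp add: inc)
    next
      fix q assume q: "q \<in> P' \<and> inc' q l \<and> inc' q m"
      then obtain q0 where q0: "q0 \<in> P" "q = f q0" using P' by blast
      then have "inc q0 l0" "inc q0 m0" using q * inc by blast+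
      then show "q = f p" using u q0 by simp
    qed
  qed
  have b3: "\<exists>S\<subseteq>P'. card S = 4 \<and>
      (\<forall>T\<subseteq>S. card T = 3 \<longrightarrow> \<not> (\<exists>l\<in>L'. \<forall>p\<in>T. inc' p l))"
  proof -
    obtain S where S: "S \<subseteq> P" "card S = 4"
      and ST: "\<And>T. T \<subseteq> S \<Longrightarrow> card T = 3 \<Longrightarrow> \<not> (\<exists>l\<in>L. \<forall>p\<in>T. inc p l)"
      using ax3 by blast
    have "\<not> (\<exists>l\<in>L'. \<forall>p\<in>T. inc' p l)" if T: "T \<subseteq> f ` S" "card T = 3" for T
    proof
      assume "\<exists>l\<in>L'. \<forall>p\<in>T. inc' p l"
      then obtain l where l: "l \<in> L" "\<forall>p\<in>T. inc' p (g l)" using L' by auto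
      obtain T0 where T0: "T0 \<subseteq> S" "T = f ` T0" using T(1) by (meson subset_imageE)
      have "card T0 = 3"
        using T(2) T0 card_image[OF inj_on_subset[OF fi]] S(1) by (metis subset_trans)
      moreover have "\<forall>p\<in>T0. inc p l" using l T0 S(1) inc by blast
      ultimately show False using ST T0(1) l(1) by blast
    qed
    moreover have "card (f ` S) = 4" using S card_image[OF inj_on_subset[OF fi]] by metis
    ultimately show ?thesis using S(1) P' by (intro exI[of _ "f ` S"]) auto
  qed
  have b4: "\<exists>l\<in>L'. card {p \<in> P'. inc' p l} = n + 1"
  proof -
    obtain l where l: "l \<in> L" "card {p \<in> P. inc p l} = n + 1" using ax4 by blast
    have "{p \<in> P'. inc' p (g l)} = f ` {p \<in> P. inc p l}" using P' inc l(1) by auto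
    moreover have "card (f ` {p \<in> P. inc p l}) = card {p \<in> P. inc p l}"
      by (rule card_image[OF inj_on_subset[OF fi]]) auto
    ultimately have "card {p \<in> P'. inc' p (g l)} = n + 1" using l(2) by simp
    then show ?thesis using l(1) L' by blast
  qed
  have b5: "n \<ge> 2" "finite P'" "finite L'" using ax5 P' L' by simp_all
  show ?thesis unfolding finite_projective_plane_def
    by (intro conjI ballI impI b1 b2 b3 b4 b5)
qed

lemma is_plane_incidence_graphI:
  fixes G :: "'a pair_pre_digraph" and P :: "'p set" and L :: "'l set"
  assumes pl: "finite_projective_plane P L inc n"
    and iso: "digraph_iso G (incidence_graph P L inc)"
  shows "is_plane_incidence_graph G n"
proof -
  have fin: "finite P" "finite L" using pl by (auto simp: finite_projective_plane_def)
  obtain f :: "'p \<Rightarrow> nat" where fi: "inj_on f P"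
    using finite_imp_inj_to_nat_seg[OF fin(1)] by blast
  obtain g :: "'l \<Rightarrow> nat" where gi: "inj_on g L"
    using finite_imp_inj_to_nat_seg[OF fin(2)] by blast
  define inc' where "inc' x y = inc (the_inv_into P f x) (the_inv_into L g y)" for x y
  have inc': "inc' (f p) (g l) \<longleftrightarrow> inc p l" if "p \<in> P" "l \<in> L" for p l
    using that fi gi by (simp add: inc'_def the_inv_into_f_f)
  have pl2: "finite_projective_plane (f ` P) (g ` L) inc' n"
    by (rule finite_projective_plane_transfer[OF pl inj_on_imp_bij_betw[OF fi]
          inj_on_imp_bij_betw[OF gi]]) (rule inc')
  let ?I = "with_proj (incidence_graph P L inc)"
  let ?J = "with_proj (incidence_graph (f ` P) (g ` L) inc')"
  let ?h = "map_sum f g"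
  define hom where "hom = \<lparr> iso_verts = ?h, iso_arcs = map_prod ?h ?h,
    iso_head = snd, iso_tail = fst \<rparr>"
  have hi: "inj_on ?h (P <+> L)"
    by (rule inj_onI) (auto dest: inj_onD[OF fi] inj_onD[OF gi])
  have wf: "wf_digraph ?I"
    by unfold_locales (auto simp: incidence_graph_def)
  have sub: "parcs (incidence_graph P L inc) \<subseteq> (P <+> L) \<times> (P <+> L)"
    by (auto simp: incidence_graph_def)
  have h: "pre_digraph.digraph_isomorphism ?I hom"
    unfolding pre_digraph.digraph_isomorphism_def
    using wf hi inj_on_subset[OF map_prod_inj_on[OF hi hi] sub]
    by (auto simp: hom_def incidence_graph_def)
  have J: "?J = app_iso hom ?I"
  proof -
    have "?h ` (P <+> L) = f ` P <+> g ` L" by force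
    moreover have "map_prod ?h ?h ` parcs (incidence_graph P L inc)
        = parcs (incidence_graph (f ` P) (g ` L) inc')"
    proof (rule equalityI; rule subsetI)
      fix e assume "e \<in> map_prod ?h ?h ` parcs (incidence_graph P L inc)"
      then show "e \<in> parcs (incidence_graph (f ` P) (g ` L) inc')"
        using inc' by (auto simp: incidence_graph_def)
    next
      fix e assume "e \<in> parcs (incidence_graph (f ` P) (g ` L) inc')"
      then obtain p l where pl: "p \<in> P" "l \<in> L" "inc p l"
        and e: "e = (Inl (f p), Inr (g l)) \<or> e = (Inr (g l), Inl (f p))"
        using inc' by (auto simp: incidence_graph_def)
      have "e = map_prod ?h ?h (Inl p, Inr l) \<or> e = map_prod ?h ?h (Inr l, Inl p)"
        using e by simp
      moreover have "(Inl p, Inr l) \<in> parcs (incidence_graph P L inc)"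
        "(Inr l, Inl p) \<in> parcs (incidence_graph P L inc)"
        using pl by (auto simp: incidence_graph_def)
      ultimately show "e \<in> map_prod ?h ?h ` parcs (incidence_graph P L inc)" by blast
    qed
    ultimately show ?thesis
      by (simp add: app_iso_def hom_def with_proj_def incidence_graph_def)
  qed
  have "digraph_iso ?I ?J" unfolding digraph_iso_def using h J by blast
  with iso have "digraph_iso G ?J" by (rule digraph_iso_trans)
  with pl2 show ?thesis unfolding is_plane_incidence_graph_def by blast
qed

end

theory Submission
  imports
    Defs
    "HOL-Analysis.Function_Topology"
    "Jordan_Normal_Form.Schur_Decomposition"
begin

text \<open>
  The distance of \<open>1\<close> from the spectrum is the square root of the minimum of the Rayleigh quotient
  \<open>(\<Sum>x. (\<Sum>v\<sim>x. g v)\<^sup>2 / deg x) / (\<Sum>v. deg v * (g v)\<^sup>2)\<close>. If some vertex has two neighbours \<open>w\<close>, \<open>w'\<close>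
  of degree \<open>d\<close>, the test function \<open>1\<close> at \<open>w\<close>, \<open>-1\<close> at \<open>w'\<close> shows that this minimum is at most
  \<open>(d - 1) / d\<^sup>2\<close>; otherwise it is strictly smaller. In the equality case that test function is a
  minimizer, which forces all vertices around \<open>w\<close> to have degree \<open>d\<close>, hence by connectedness \<open>G\<close> is
  \<open>d\<close>-regular. The eigenvalue equation for the minimizer then says that being equal or having a
  common neighbour is an equivalence relation and that common neighbours are unique. Either there are
  two classes, which are the points and lines of a projective plane, or there is only one; the latter
  is excluded by the trace argument of the friendship theorem.
\<close>

section \<open>The Rayleigh quotient\<close>

text \<open>The analytic part uses only a vertex set and a neighbourhood function, with real
  functions on all of \<open>'a\<close>. Nonempty neighbourhoods make division by a degree
  meaningful.\<close>

locale neighbourhood_graph =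
  fixes V :: "'a set" and N :: "'a \<Rightarrow> 'a set"
  assumes finite_V: "finite V"
    and N_subset: "v \<in> V \<Longrightarrow> N v \<subseteq> V"
    and N_sym: "v \<in> V \<Longrightarrow> w \<in> N v \<Longrightarrow> v \<in> N w"
    and N_irrefl: "v \<in> V \<Longrightarrow> v \<notin> N v"
    and N_nonempty: "v \<in> V \<Longrightarrow> N v \<noteq> {}"
begin

abbreviation deg :: "'a \<Rightarrow> real" where "deg v \<equiv> real (card (N v))"

definition nsum :: "('a \<Rightarrow> real) \<Rightarrow> 'a \<Rightarrow> real" where
  "nsum g x = (\<Sum>v\<in>N x. g v)"

text \<open>The operator D^-1 A = I - L is self-adjoint for the degree-weighted inner product. In
  that inner product \<open>energy g\<close> is the squared norm of its value at \<open>g\<close>,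
  and \<open>mass g\<close> the squared norm of \<open>g\<close>; so
  \<open>energy g / mass g\<close> is the Rayleigh quotient of the square of I - L.\<close>

definition energy :: "('a \<Rightarrow> real) \<Rightarrow> real" where
  "energy g = (\<Sum>x\<in>V. (nsum g x)\<^sup>2 / deg x)"

definition mass :: "('a \<Rightarrow> real) \<Rightarrow> real" where
  "mass g = (\<Sum>v\<in>V. deg v * (g v)\<^sup>2)"

definition form :: "real \<Rightarrow> ('a \<Rightarrow> real) \<Rightarrow> real" where
  "form r g = energy g - r * mass g"

text \<open>The diagonal entries of the quadratic form \<open>form r\<close>; \<open>codeg\<close>
  gives its off-diagonal entries.\<close>

definition excess :: "real \<Rightarrow> 'a \<Rightarrow> real" where
  "excess r v = (\<Sum>x\<in>N v. 1 / deg x) - r * deg v"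

definition codeg :: "'a \<Rightarrow> 'a \<Rightarrow> real" where
  "codeg v w = (\<Sum>x\<in>N v \<inter> N w. 1 / deg x)"

lemma finite_N [simp]: "v \<in> V \<Longrightarrow> finite (N v)"
  using finite_V N_subset finite_subset by blast

lemma N_V: "w \<in> N v \<Longrightarrow> v \<in> V \<Longrightarrow> w \<in> V"
  using N_subset by blast

lemma N_commute: "v \<in> V \<Longrightarrow> w \<in> V \<Longrightarrow> w \<in> N v \<longleftrightarrow> v \<in> N w"
  using N_sym by blast

lemma deg_pos: "v \<in> V \<Longrightarrow> 0 < deg v"
  using N_nonempty by (simp add: card_gt_0_iff)

lemma energy_nonneg: "0 \<le> energy g"
  unfolding energy_def by (intro sum_nonneg) auto

lemma mass_pos: assumes "v \<in> V" "g v \<noteq> 0" shows "0 < mass g"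
proof -
  have "0 < deg v * (g v)\<^sup>2" using assms deg_pos by simp
  also have "\<dots> \<le> mass g" unfolding mass_def
    by (rule member_le_sum) (use assms finite_V in auto)
  finally show ?thesis .
qed

lemma nsum_perturb:
  assumes "x \<in> V" "v \<in> V"
  shows "nsum (g(v := g v + t)) x = nsum g x + (if x \<in> N v then t else 0)"
proof -
  have "nsum (g(v := g v + t)) x = (\<Sum>y\<in>N x. g y + (if y = v then t else 0))"
    unfolding nsum_def by (intro sum.cong) auto
  also have "\<dots> = nsum g x + (if v \<in> N x then t else 0)"
    using assms by (simp add: sum.distrib nsum_def)
  finally show ?thesis using N_commute assms by simp
qed

text \<open>Along one coordinate the form is a quadratic polynomial in \<open>t\<close>: the linear
  coefficient yields the eigenvalue equation, the leading one is the diagonal entry. Expanding from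
  the zero function gives the values on test functions.\<close>

lemma form_perturb:
  assumes v: "v \<in> V"
  shows "form r (g(v := g v + t)) = form r g
    + 2 * t * ((\<Sum>x\<in>N v. nsum g x / deg x) - r * deg v * g v) + t\<^sup>2 * excess r v"
proof -
  let ?g = "g(v := g v + t)"
  have "energy ?g = (\<Sum>x\<in>V. (nsum g x)\<^sup>2 / deg x
      + (if x \<in> N v then 2 * t * (nsum g x / deg x) + t\<^sup>2 * (1 / deg x) else 0))"
    unfolding energy_def using v
    by (intro sum.cong refl) (simp add: nsum_perturb power2_sum add_divide_distrib)
  also have "\<dots> = energy g
      + (\<Sum>x\<in>V. if x \<in> N v then 2 * t * (nsum g x / deg x) + t\<^sup>2 * (1 / deg x) else 0)"
    by (simp add: sum.distrib energy_def)
  also have "(\<Sum>x\<in>V. if x \<in> N v then 2 * t * (nsum g x / deg x) + t\<^sup>2 * (1 / deg x) else 0)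
      = (\<Sum>x\<in>N v. 2 * t * (nsum g x / deg x) + t\<^sup>2 * (1 / deg x))"
    using N_subset[OF v] finite_V by (intro sum.mono_neutral_cong_right) auto
  also have "\<dots> = 2 * t * (\<Sum>x\<in>N v. nsum g x / deg x) + t\<^sup>2 * (\<Sum>x\<in>N v. 1 / deg x)"
    by (simp only: sum.distrib sum_distrib_left)
  finally have e: "energy ?g = energy g + (2 * t * (\<Sum>x\<in>N v. nsum g x / deg x)
      + t\<^sup>2 * (\<Sum>x\<in>N v. 1 / deg x))" .
  have "mass ?g = (\<Sum>y\<in>V. deg y * (g y)\<^sup>2 + (if y = v then deg v * (2 * t * g v + t\<^sup>2) else 0))"
    unfolding mass_def by (intro sum.cong) (auto simp: power2_sum algebra_simps)
  also have "\<dots> = mass g + deg v * (2 * t * g v + t\<^sup>2)"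
    using v finite_V by (simp add: sum.distrib mass_def)
  finally show ?thesis unfolding form_def e excess_def by (simp add: algebra_simps)
qed

text \<open>At a zero of a nonnegative form the linear coefficient of \<open>form_perturb\<close>
  must vanish, since otherwise a small step of the right sign would make the form negative.\<close>

lemma form_minimizer_eigen:
  assumes nonneg: "\<And>h. 0 \<le> form r h" and zero: "form r g = 0" and v: "v \<in> V"
  shows "(\<Sum>x\<in>N v. nsum g x / deg x) = r * deg v * g v"
proof -
  define K where "K = (\<Sum>x\<in>N v. nsum g x / deg x) - r * deg v * g v"
  \<comment> \<open>For this \<open>c\<close> the step \<open>- K / c\<close> has linear term
    \<open>- 2 * K\<^sup>2 / c\<close>, which outweighs the quadratic term, at most
    \<open>K\<^sup>2 / c\<close>.\<close>
  define c where "c = \<bar>excess r v\<bar> + 1"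
  have "0 \<le> 2 * t * K + t\<^sup>2 * excess r v" for t
    using nonneg[of "g(v := g v + t)"] form_perturb[OF v, of r g t] zero by (simp add: K_def)
  from this[of "- K / c"] have "0 \<le> - 2 * K\<^sup>2 / c + K\<^sup>2 / c\<^sup>2 * excess r v"
    by (simp add: power2_eq_square)
  also have "K\<^sup>2 / c\<^sup>2 * excess r v \<le> K\<^sup>2 / c\<^sup>2 * c"
    by (intro mult_left_mono) (auto simp: c_def)
  also have "\<dots> = K\<^sup>2 / c" by (simp add: power2_eq_square)
  finally have "K\<^sup>2 / c \<le> 0" by (simp add: field_simps)
  moreover have "c > 0" by (simp add: c_def)
  ultimately have "K = 0" by (simp add: divide_le_0_iff)
  then show ?thesis by (simp add: K_def)
qed

section \<open>Test functions supported on one or two vertices\<close>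

lemma form_single: "v \<in> V \<Longrightarrow> form r ((\<lambda>_. 0)(v := 1)) = excess r v"
  using form_perturb[of v r "\<lambda>_. 0" 1]
  by (simp add: nsum_def form_def energy_def mass_def)

lemma nsum_single: "x \<in> V \<Longrightarrow> v \<in> V \<Longrightarrow>
    nsum ((\<lambda>_. 0)(v := 1)) x = (if x \<in> N v then 1 else 0)"
  using nsum_perturb[of x v "\<lambda>_. 0" 1] by (simp add: nsum_def)

definition diff :: "'a \<Rightarrow> 'a \<Rightarrow> 'a \<Rightarrow> real" where
  "diff v w = (\<lambda>_. 0)(v := 1, w := - 1)"

lemma form_diff:
  assumes "v \<in> V" "w \<in> V" "v \<noteq> w"
  shows "form r (diff v w) = excess r v + excess r w - 2 * codeg v w"
proof -
  let ?e = "(\<lambda>_. 0 :: real)(v := 1)"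
  have "(\<Sum>x\<in>N w. nsum ?e x / deg x) = (\<Sum>x\<in>N w. if x \<in> N v then 1 / deg x else 0)"
    using assms by (intro sum.cong) (auto simp: nsum_single dest: N_V)
  also have "\<dots> = codeg v w" unfolding codeg_def
    using assms by (intro sum.mono_neutral_cong_right) auto
  finally show ?thesis
    using form_perturb[OF assms(2), of r ?e "- 1"] form_single[of v r] assms
    by (simp add: diff_def)
qed

lemma nsum_diff: "x \<in> V \<Longrightarrow> v \<in> V \<Longrightarrow> w \<in> V \<Longrightarrow> v \<noteq> w \<Longrightarrow>
    nsum (diff v w) x = (if x \<in> N v then 1 else 0) - (if x \<in> N w then 1 else 0)"
  using nsum_perturb[of x w "(\<lambda>_. 0)(v := 1)" "-1"] by (simp add: nsum_single diff_def)

lemma mass_diff_pos: "v \<in> V \<Longrightarrow> v \<noteq> w \<Longrightarrow> 0 < mass (diff v w)"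
  by (rule mass_pos[of v]) (auto simp: diff_def)

lemma energy_scale: "energy (\<lambda>v. c * g v) = c\<^sup>2 * energy g"
  by (simp add: energy_def nsum_def sum_distrib_left[symmetric] power_mult_distrib)
    (simp add: sum_distrib_left)

lemma mass_scale: "mass (\<lambda>v. c * g v) = c\<^sup>2 * mass g"
  by (simp add: mass_def power_mult_distrib sum_distrib_left algebra_simps)

lemma mass_nonneg: "0 \<le> mass g"
  unfolding mass_def by (intro sum_nonneg) auto

text \<open>The Rayleigh quotient is invariant under scaling and ignores values outside
  \<open>V\<close>, so its minimum \<open>r\<close> is attained on the compact slice of mass
  one.\<close>

lemma rayleigh_minimizer:
  assumes "V \<noteq> {}"
  obtains r g v where "\<And>h. 0 \<le> form r h" "form r g = 0" "v \<in> V" "g v \<noteq> 0"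
proof -
  \<comment> \<open>The type \<open>'a\<close> may be infinite; with all coordinates outside
    \<open>V\<close> pinned to \<open>0\<close>, \<open>K\<close> is a product of compact sets and
    hence compact.\<close>
  define K where "K = (PiE UNIV (\<lambda>v. if v \<in> V then {-1..1} else {0 :: real}))"
  have "compactin (product_topology (\<lambda>i. euclidean) UNIV) K"
    unfolding K_def compactin_PiE by auto
  then have K: "compact K" by (simp add: euclidean_product_topology)
  have coord: "continuous_on T (\<lambda>g :: 'a \<Rightarrow> real. g v)" for T v
    by (rule continuous_on_subset[OF continuous_on_product_coordinates]) auto
  have cont_mass: "continuous_on T mass" for T
    unfolding mass_def by (intro continuous_intros coord)
  have cont_energy: "continuous_on T energy" for T
    unfolding energy_def nsum_def divide_inverse by (intro continuous_intros coord)
  define S where "S = K \<inter> mass -` {1}"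
  have "closed (mass -` {1})"
    using continuous_closed_preimage[OF cont_mass[of UNIV], of "{1}"] by simp
  then have S: "compact S" unfolding S_def using K by blast
  \<comment> \<open>Cutting \<open>h\<close> down to \<open>V\<close> and scaling it to mass one
    keeps the quotient.\<close>
  have inS: "\<exists>g\<in>S. energy g = energy h / mass h" if h: "0 < mass h" for h
  proof
    define c where "c = 1 / sqrt (mass h)"
    define g where "g v = c * (if v \<in> V then h v else 0)" for v
    have eq: "energy (\<lambda>v. if v \<in> V then h v else 0) = energy h"
      "mass (\<lambda>v. if v \<in> V then h v else 0) = mass h"
      unfolding energy_def mass_def nsum_def
       by (auto intro!: sum.cong arg_cong2[where f="(/)"] arg_cong2[where f="power"] dest: N_V)
    have c2: "c\<^sup>2 = 1 / mass h" using h by (simp add: c_def power_divide)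
    have m: "mass g = 1" unfolding g_def mass_scale eq using c2 h by simp
    show "energy g = energy h / mass h" unfolding g_def energy_scale eq using c2 by simp
    have "g v \<in> {-1..1}" if v: "v \<in> V" for v
    proof -
      \<comment> \<open>Degrees are at least one, so mass one bounds each coordinate by one: the
        cube \<open>K\<close> contains every normalized function.\<close>
      have "1 * (g v)\<^sup>2 \<le> deg v * (g v)\<^sup>2"
        using deg_pos[OF v] by (intro mult_right_mono) auto
      also have "\<dots> \<le> mass g" unfolding mass_def
        by (rule member_le_sum) (use v finite_V in auto)
      finally have "(g v)\<^sup>2 \<le> 1" using m by simp
      then show ?thesis by (simp add: abs_square_le_1 abs_le_iff)
    qed
    then show "g \<in> S" using m by (auto simp: S_def K_def g_def)
  qed
  obtain v where v: "v \<in> V" using assms by blast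
  have "0 < mass (\<lambda>_. 1)" using v by (intro mass_pos[of v]) auto
  then have "S \<noteq> {}" using inS by blast
  then obtain g where g: "g \<in> S" and min: "\<And>h. h \<in> S \<Longrightarrow> energy g \<le> energy h"
    using continuous_attains_inf[OF S _ cont_energy] by blast
  have m: "mass g = 1" using g by (simp add: S_def)
  have "0 \<le> form (energy g) h" for h
  proof (cases "mass h = 0")
    case True then show ?thesis by (simp add: form_def energy_nonneg)
  next
    case False
    then have p: "0 < mass h" using mass_nonneg[of h] by simp
    then obtain g' where "g' \<in> S" "energy g' = energy h / mass h" using inS by blast
    then have "energy g \<le> energy h / mass h" using min by metis
    then show ?thesis using p by (simp add: form_def field_simps)
  qed
  moreover have "form (energy g) g = 0" by (simp add: form_def m)
  moreover obtain u where "u \<in> V" "g u \<noteq> 0"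
    using m unfolding mass_def
    by (metis (mono_tags, lifting) mult_zero_right sum.neutral zero_neq_one zero_power2)
  ultimately show thesis by (rule that)
qed

text \<open>The minimizer is an eigenvector of the square of D^-1 A for \<open>r\<close>. With
  \<open>s = sqrt r\<close> the product (D^-1 A + s)(D^-1 A - s) annihilates \<open>g\<close>, so
  either \<open>g\<close> is an eigenvector for \<open>s\<close>, or its image under the second
  factor is one for \<open>- s\<close>.\<close>

lemma rayleigh_eigenvalue:
  assumes "\<And>h. 0 \<le> form r h" "form r g = 0" "v \<in> V" "g v \<noteq> 0"
  obtains \<mu> f u where "\<bar>\<mu>\<bar> = sqrt r" "u \<in> V" "f u \<noteq> 0"
    "\<And>x. x \<in> V \<Longrightarrow> nsum f x = \<mu> * deg x * f x"
proof -
  have "r * mass g = energy g" using assms(2) by (simp add: form_def)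
  then have "0 \<le> r * mass g" using energy_nonneg by simp
  then have r: "0 \<le> r"
    using mass_pos[of v g] assms(3,4) by (simp add: zero_le_mult_iff)
  define s where "s = sqrt r"
  have s: "s * s = r" "\<bar>s\<bar> = sqrt r" using r by (auto simp: s_def)
  define T where "T x = nsum g x / deg x" for x
  have ng: "nsum g x = deg x * T x" if "x \<in> V" for x
    using deg_pos[OF that] by (simp add: T_def)
  have nT: "nsum T x = r * deg x * g x" if "x \<in> V" for x
    using form_minimizer_eigen[OF assms(1,2) that] by (simp add: nsum_def T_def)
  show thesis
  proof (cases "\<forall>x\<in>V. T x = s * g x")
    case True
    show thesis
    proof (rule that[of s v g])
      show "nsum g x = s * deg x * g x" if "x \<in> V" for x using True ng that by simp
    qed (use s assms in auto)
  next
    case False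
    then obtain u where u: "u \<in> V" "T u - s * g u \<noteq> 0" by auto
    show thesis
    proof (rule that[of "- s" u "\<lambda>x. T x - s * g x"])
      fix x assume x: "x \<in> V"
      have "nsum (\<lambda>x. T x - s * g x) x = nsum T x - s * nsum g x"
        by (simp add: nsum_def sum_subtractf sum_distrib_left)
      also have "\<dots> = - s * deg x * (T x - s * g x)"
        using ng[OF x] nT[OF x] s(1) by (simp add: algebra_simps)
      finally show "nsum (\<lambda>x. T x - s * g x) x = - s * deg x * (T x - s * g x)" .
    qed (use s u in auto)
  qed
qed

end

section \<open>Test functions and regularity\<close>

text \<open>At most one index violates the bound \<open>b\<close>; that index, or an arbitrary one
  if there is none, is charged \<open>a\<close>. The natural subtraction is exact because
  \<open>S\<close> is nonempty.\<close>

lemma sum_le_one_exception: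
  fixes f :: "'a \<Rightarrow> real" and a b :: real
  assumes fin: "finite S" and ne: "S \<noteq> {}" and le: "\<And>x. x \<in> S \<Longrightarrow> f x \<le> a"
    and one: "\<And>x y. x \<in> S \<Longrightarrow> y \<in> S \<Longrightarrow> x \<noteq> y \<Longrightarrow> f x \<le> b \<or> f y \<le> b"
  shows "sum f S \<le> a + (card S - 1) * b"
proof -
  obtain z where z: "z \<in> S" "\<And>x. x \<in> S - {z} \<Longrightarrow> f x \<le> b"
  proof (cases "\<exists>z\<in>S. \<not> f z \<le> b")
    case True then show ?thesis using one that by blast
  next
    case False then show ?thesis using ne that by blast
  qed
  have "sum f S = f z + sum f (S - {z})" using fin z(1) by (rule sum.remove)
  also have "sum f (S - {z}) \<le> of_nat (card (S - {z})) * b"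
    by (rule sum_bounded_above) (rule z)
  finally show ?thesis using le[OF z(1)] fin z(1) by simp
qed

lemma exists_other: "finite A \<Longrightarrow> 2 \<le> card A \<Longrightarrow> \<exists>y\<in>A. y \<noteq> x"
  using card_mono[of "{x}" A] by fastforce

text \<open>Connectedness is phrased through sets closed under neighbours, the form in which a local
  property spreads over the graph.\<close>

locale min_degree_graph = neighbourhood_graph V N for V :: "'a set" and N +
  fixes d :: nat
  assumes d_ge_3: "3 \<le> d"
    and V_nonempty: "V \<noteq> {}"
    and min_degree: "v \<in> V \<Longrightarrow> d \<le> card (N v)"
    and connected: "S \<subseteq> V \<Longrightarrow> S \<noteq> {} \<Longrightarrow> (\<And>v. v \<in> S \<Longrightarrow> N v \<subseteq> S) \<Longrightarrow> S = V"
begin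

text \<open>The square of the claimed bound, on the scale of Rayleigh quotients.\<close>

definition gap :: real where "gap = (real d - 1) / (real d)\<^sup>2"

lemma deg_ge: "v \<in> V \<Longrightarrow> real d \<le> deg v"
  using min_degree by simp

lemma inverse_deg_le: "v \<in> V \<Longrightarrow> 1 / deg v \<le> 1 / d"
  using deg_ge[of v] d_ge_3 by (intro divide_left_mono) auto

text \<open>A common neighbour \<open>u\<close> is singled out because in \<open>form_diff\<close>
  its terms \<open>1 / deg u\<close> in the two excesses cancel against those in
  \<open>2 * codeg\<close>.\<close>

lemma excess_split:
  assumes "u \<in> V" "w \<in> N u"
  shows "excess r w = 1 / deg u + (\<Sum>x\<in>N w - {u}. 1 / deg x) - r * deg w"
proof -
  have "w \<in> V" "u \<in> N w" using assms N_V N_sym by blast+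
  then have "(\<Sum>x\<in>N w. 1 / deg x) = 1 / deg u + (\<Sum>x\<in>N w - {u}. 1 / deg x)"
    by (intro sum.remove) auto
  then show ?thesis by (simp add: excess_def)
qed

lemma codeg_split:
  assumes "u \<in> V" "w \<in> N u" "w' \<in> N u"
  shows "codeg w w' = 1 / deg u + (\<Sum>x\<in>N w \<inter> N w' - {u}. 1 / deg x)"
proof -
  have "w \<in> V" "u \<in> N w" "u \<in> N w'" using assms N_V N_sym by blast+
  then show ?thesis unfolding codeg_def by (intro sum.remove) auto
qed

lemma codeg_ge:
  assumes "u \<in> V" "w \<in> N u" "w' \<in> N u"
  shows "1 / deg u \<le> codeg w w'"
  unfolding codeg_split[OF assms] by (simp add: sum_nonneg)

text \<open>Standing assumption: no Rayleigh quotient lies below \<open>gap\<close>. It holds both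
  when the minimum is supposed to exceed \<open>gap\<close>, which is to be refuted, and in the
  equality case.\<close>

context
  assumes form_nonneg: "\<And>h. 0 \<le> form gap h"
begin

text \<open>Apart from \<open>u\<close>, a neighbour of degree \<open>d\<close> has
  \<open>d - 1\<close> neighbours contributing at most \<open>1 / d\<close> each, and
  \<open>gap * d\<close> is exactly \<open>(d - 1) / d\<close>. The form at \<open>diff w w'\<close>
  is therefore minus a sum of nonnegative slacks, all of which must vanish.\<close>

lemma degree_d_neighbours:
  assumes u: "u \<in> V" and w: "w \<in> N u" "w' \<in> N u" "w \<noteq> w'"
    and dw: "card (N w) = d" "card (N w') = d"
  shows "form gap (diff w w') = 0" and "N w \<inter> N w' = {u}"
    and "\<And>x. x \<in> N w - {u} \<Longrightarrow> card (N x) = d"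
proof -
  have V: "w \<in> V" "w' \<in> V" using u w N_V by blast+
  \<comment> \<open>\<open>R\<close> collects the slack in \<open>1 / deg x \<le> 1 / d\<close>;
    \<open>X\<close> is the contribution of common neighbours other than \<open>u\<close>.\<close>
  define R where "R w = (\<Sum>x\<in>N w - {u}. 1 / d - 1 / deg x)" for w
  define X where "X = (\<Sum>x\<in>N w \<inter> N w' - {u}. 1 / deg x)"
  have R_term: "0 \<le> 1 / d - 1 / deg x" if "v \<in> V" "x \<in> N v - {u}" for v x
    using inverse_deg_le[of x] N_V[of x v] that by simp
  have R: "0 \<le> R v" if "v \<in> V" for v
    unfolding R_def using R_term[OF that] by (rule sum_nonneg)
  have X: "0 \<le> X" unfolding X_def by (intro sum_nonneg) auto
  have ex: "excess gap v = 1 / deg u - R v" if "v \<in> N u" "card (N v) = d" for v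
  proof -
    have "v \<in> V" "u \<in> N v" using that u N_V N_sym by blast+
    then have "card (N v - {u}) = d - 1" using that by simp
    then have "R v = (real d - 1) / d - (\<Sum>x\<in>N v - {u}. 1 / deg x)"
      using d_ge_3 by (simp add: R_def sum_subtractf of_nat_diff)
    moreover have "gap * deg v = (real d - 1) / d"
      using d_ge_3 that by (simp add: gap_def power2_eq_square)
    ultimately show ?thesis using excess_split[OF u that(1), of gap] by simp
  qed
  have f: "form gap (diff w w') = - R w - R w' - 2 * X"
    using form_diff[OF V w(3)] ex[OF w(1) dw(1)] ex[OF w(2) dw(2)] codeg_split[OF u w(1,2)]
    by (simp add: X_def)
  with R[OF V(1)] R[OF V(2)] X form_nonneg[of "diff w w'"]
  have z: "R w = 0" "R w' = 0" "X = 0" by linarith+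
  show "form gap (diff w w') = 0" using f z by simp
  show "N w \<inter> N w' = {u}"
  proof (rule ccontr)
    assume "N w \<inter> N w' \<noteq> {u}"
    moreover have "u \<in> N w \<inter> N w'" using u w N_sym by blast
    ultimately obtain x where x: "x \<in> N w \<inter> N w' - {u}" by blast
    have "0 < 1 / deg x" using x V N_V deg_pos by auto
    also have "\<dots> \<le> X" unfolding X_def
      by (rule member_le_sum) (use x V in auto)
    finally show False using z by simp
  qed
  fix x assume x: "x \<in> N w - {u}"
  have "1 / d - 1 / deg x = 0"
  proof (rule sum_nonneg_0[where f = "\<lambda>x. 1 / d - 1 / deg x"])
    show "(\<Sum>x\<in>N w - {u}. 1 / d - 1 / deg x) = 0" using z(1) by (simp only: R_def)
    show "finite (N w - {u})" using V by simp
  qed (rule R_term[OF V(1)] x, assumption?)+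
  then show "card (N x) = d" using d_ge_3 deg_pos[of x] x V N_V by (simp add: field_simps)
qed

text \<open>
  If no vertex has two neighbours of degree \<open>d\<close>, then \<open>diff x y\<close> makes the form negative for any two
  neighbours \<open>x\<close>, \<open>y\<close> of a vertex that both have degree below \<open>d\<^sup>2 - d\<close>. So every vertex has at most
  one neighbour of degree below \<open>d\<^sup>2 - d\<close>, and then the indicator of any vertex of degree greater than
  \<open>d\<close> makes the form negative.
\<close>
lemma exists_degree_d_neighbours:
  "\<exists>u\<in>V. \<exists>w\<in>N u. \<exists>w'\<in>N u. w \<noteq> w' \<and> card (N w) = d \<and> card (N w') = d"
proof (rule ccontr)
  assume "\<not> ?thesis"
  then have one_d: "card (N x) \<noteq> d \<or> card (N y) \<noteq> d"
    if "u \<in> V" "x \<in> N u" "y \<in> N u" "x \<noteq> y" for u x y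
    using that by blast
  define D where "D = real d"
  have D: "3 \<le> D" using d_ge_3 by (simp add: D_def)
  have gap_D: "gap = (D - 1) / D\<^sup>2" by (simp add: gap_def D_def)
  have inv_le: "1 / deg x \<le> 1 / (D + 1)" if "x \<in> V" "card (N x) \<noteq> d" for x
  proof -
    have "d + 1 \<le> card (N x)" using min_degree[of x] that by simp
    then have "D + 1 \<le> deg x" unfolding D_def by linarith
    then show ?thesis using D by (intro divide_left_mono) auto
  qed
  have small: "excess gap w < 1 / deg u"
    if u: "u \<in> V" and w: "w \<in> N u" and q: "deg w < D\<^sup>2 - D" for u w
  proof -
    have V: "w \<in> V" "u \<in> N w" using u w N_V N_sym by blast+
    have card: "card (N w - {u}) = card (N w) - 1" using V by simp
    have q3: "3 \<le> card (N w)" using min_degree[OF V(1)] d_ge_3 by simp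
    \<comment> \<open>Among the neighbours of \<open>w\<close> other than \<open>u\<close> at most
      one has degree \<open>d\<close>; the remaining ones have degree at least
      \<open>D + 1\<close>.\<close>
    have "(\<Sum>x\<in>N w - {u}. 1 / deg x) \<le> 1 / D + (card (N w - {u}) - 1) * (1 / (D + 1))"
    proof (rule sum_le_one_exception)
      show "N w - {u} \<noteq> {}" using card q3 by force
      show "1 / deg x \<le> 1 / D" if "x \<in> N w - {u}" for x
        using that V N_V inverse_deg_le unfolding D_def by blast
      show "1 / deg x \<le> 1 / (D + 1) \<or> 1 / deg y \<le> 1 / (D + 1)"
        if "x \<in> N w - {u}" "y \<in> N w - {u}" "x \<noteq> y" for x y
        using one_d[of w x y] inv_le that V N_V by blast
    qed (use V in auto)
    also have "real (card (N w - {u}) - 1) = deg w - 2"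
      unfolding card using q3 by (simp add: of_nat_diff)
    finally have "excess gap w \<le> 1 / deg u + (1 / D + (deg w - 2) / (D + 1) - gap * deg w)"
      using excess_split[OF u w, of gap] by simp
    \<comment> \<open>The sign changes at \<open>deg w = D\<^sup>2 - D\<close>, which is where the
      threshold comes from.\<close>
    also have "1 / D + (deg w - 2) / (D + 1) - gap * deg w = (deg w - (D\<^sup>2 - D)) / (D\<^sup>2 * (D + 1))"
      using D unfolding gap_D by (simp add: divide_simps power2_eq_square) (simp add: algebra_simps)
    also have "\<dots> < 0" using q D by (intro divide_neg_pos) auto
    finally show ?thesis by simp
  qed
  have one_small: "D\<^sup>2 - D \<le> deg x \<or> D\<^sup>2 - D \<le> deg y"
    if u: "u \<in> V" and xy: "x \<in> N u" "y \<in> N u" "x \<noteq> y" for u x y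
  proof (rule ccontr)
    assume "\<not> ?thesis"
    then have "excess gap x < 1 / deg u" "excess gap y < 1 / deg u"
      using small u xy by auto
    moreover have "x \<in> V" "y \<in> V" using u xy N_V by blast+
    ultimately have "form gap (diff x y) < 0"
      using form_diff[of x y gap] codeg_ge[OF u xy(1,2)] xy(3) by simp
    then show False using form_nonneg by (simp add: not_less[symmetric])
  qed
  obtain v where v: "v \<in> V" using V_nonempty by blast
  obtain x where x: "x \<in> N v" using N_nonempty[OF v] by blast
  moreover obtain y where "y \<in> N v" "y \<noteq> x"
    using exists_other[of "N v" x] min_degree[OF v] d_ge_3 v by auto
  ultimately obtain u where u: "u \<in> V" "card (N u) \<noteq> d" using one_d[OF v] N_V v by blast
  define p where "p = deg u"
  have p: "D + 1 \<le> p" using u min_degree[of u] unfolding p_def D_def by linarith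
  have DD: "0 < D\<^sup>2 - D" "D \<le> D\<^sup>2 - D"
    using D by (auto simp: power2_eq_square algebra_simps mult_left_mono intro: order_trans[of _ "3 * D"])
  have "(\<Sum>x\<in>N u. 1 / deg x) \<le> 1 / D + (card (N u) - 1) * (1 / (D\<^sup>2 - D))"
  proof (rule sum_le_one_exception)
    show "1 / deg x \<le> 1 / D" if "x \<in> N u" for x
      using that u N_V inverse_deg_le unfolding D_def by blast
    show "1 / deg x \<le> 1 / (D\<^sup>2 - D) \<or> 1 / deg y \<le> 1 / (D\<^sup>2 - D)"
      if "x \<in> N u" "y \<in> N u" "x \<noteq> y" for x y
      using one_small[OF u(1) that] DD(1) by (auto intro!: divide_left_mono mult_pos_pos)
  qed (use u N_nonempty in auto)
  also have "real (card (N u) - 1) = p - 1"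
    using deg_pos[OF u(1)] by (simp add: p_def of_nat_diff)
  finally have "excess gap u \<le> 1 / D + (p - 1) / (D\<^sup>2 - D) - gap * p"
    by (simp add: excess_def p_def)
  also have "\<dots> = (D\<^sup>2 - 2 * D - p * (D\<^sup>2 - 3 * D + 1)) / (D\<^sup>2 * (D - 1))"
    using D DD unfolding gap_D by (simp add: divide_simps power2_eq_square) (simp add: algebra_simps)
  also have "\<dots> < 0"
  proof (rule divide_neg_pos)
    \<comment> \<open>The coefficient of \<open>p\<close> is negative, as
      \<open>D\<^sup>2 - 3 * D + 1 = D * (D - 3) + 1\<close>, so the worst case is
      \<open>p = D + 1\<close>; there the numerator equals
      \<open>- D\<^sup>2 * (D - 3) - 1\<close>.\<close>
    have "0 \<le> D * (D - 3)" using D by simp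
    then have "(D + 1) * (D\<^sup>2 - 3 * D + 1) \<le> p * (D\<^sup>2 - 3 * D + 1)"
      using p by (intro mult_right_mono) (auto simp: power2_eq_square algebra_simps)
    moreover have "0 \<le> D\<^sup>2 * (D - 3)" using D by simp
    ultimately show "D\<^sup>2 - 2 * D - p * (D\<^sup>2 - 3 * D + 1) < 0"
      by (simp add: power2_eq_square algebra_simps)
  qed (use D in auto)
  finally show False using form_nonneg form_single[OF u(1)] by (metis not_less)
qed

text \<open>If a vertex and all its neighbours have degree \<open>d\<close>, then
  \<open>degree_d_neighbours\<close>, applied at that vertex to pairs of its neighbours, gives each
  neighbour the same property. Such vertices form a closed set, so one of them suffices.\<close>

lemma regular: assumes "v \<in> V" shows "card (N v) = d"
proof -
  define S where "S = {x \<in> V. card (N x) = d \<and> (\<forall>y\<in>N x. card (N y) = d)}"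
  have step: "card (N x) = d"
    if "u \<in> V" "w \<in> N u" "w' \<in> N u" "w \<noteq> w'" "card (N w) = d" "card (N w') = d"
      "card (N u) = d" "x \<in> N w" for u w w' x
    using degree_d_neighbours(3)[OF that(1-6)] that(7,8) by (cases "x = u") auto
  obtain u w w' where uw: "u \<in> V" "w \<in> N u" "w' \<in> N u" "w \<noteq> w'" "card (N w) = d" "card (N w') = d"
    using exists_degree_d_neighbours by blast
  have w: "w \<in> V" "u \<in> N w" using uw N_V N_sym by blast+
  \<comment> \<open>The degree of \<open>u\<close> is not yet known, so the start moves to
    \<open>w\<close>: since \<open>3 \<le> d\<close>, it has two neighbours \<open>x\<close>,
    \<open>x'\<close> besides \<open>u\<close>, both of degree \<open>d\<close>, and
    \<open>step\<close> at \<open>w\<close> puts \<open>x\<close> into \<open>S\<close>.\<close>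
  have "2 \<le> card (N w - {u})" using w uw d_ge_3 by simp
  then obtain x where x: "x \<in> N w - {u}" using exists_other[of "N w - {u}"] w by auto
  with \<open>2 \<le> card (N w - {u})\<close> obtain x' where x': "x' \<in> N w - {u}" "x' \<noteq> x"
    using exists_other[of "N w - {u}" x] w by auto
  have dx: "card (N x) = d" "card (N x') = d"
    using degree_d_neighbours(3)[OF uw] x x' by auto
  have "x \<in> V" using x w N_V by blast
  then have "x \<in> S" unfolding S_def using dx x x' step[OF w(1), of x x'] uw(5) by auto
  moreover have "N y \<subseteq> S" if "y \<in> S" for y
  proof
    fix z assume z: "z \<in> N y"
    have y: "y \<in> V" "card (N y) = d" "\<forall>x\<in>N y. card (N x) = d" using that by (auto simp: S_def)
    obtain z' where z': "z' \<in> N y" "z' \<noteq> z" using exists_other[of "N y" z] y d_ge_3 by auto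
    show "z \<in> S" unfolding S_def using y z z' step[OF y(1), of z z'] N_V by auto
  qed
  moreover have "S \<subseteq> V" by (auto simp: S_def)
  ultimately have "S = V" using connected by blast
  then show ?thesis using assms by (auto simp: S_def)
qed

lemma common_neighbour_unique:
  assumes "w \<in> V" "w' \<in> V" "w \<noteq> w'" "u \<in> N w" "u \<in> N w'"
  shows "N w \<inter> N w' = {u}" and "form gap (diff w w') = 0"
  using degree_d_neighbours(1,2)[of u w w'] regular assms N_V N_sym by blast+

text \<open>The function \<open>diff w w'\<close> is a minimizer and so satisfies the eigenvalue
  equation. At \<open>v\<close> it vanishes, and by regularity the equation there says that the two
  counts differ by zero.\<close>

lemma common_neighbours_transfer:
  assumes w: "w \<in> V" "w' \<in> V" "w \<noteq> w'" "u \<in> N w" "u \<in> N w'"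
    and v: "v \<in> V" "v \<noteq> w" "v \<noteq> w'"
  shows "card (N v \<inter> N w) = card (N v \<inter> N w')"
proof -
  have cnt: "(\<Sum>x\<in>N v. if x \<in> N w then 1 else 0 :: real) = card (N v \<inter> N w)" for w
    using v by (simp add: sum.If_cases Int_def)
  have "(\<Sum>x\<in>N v. nsum (diff w w') x / deg x) = gap * deg v * diff w w' v"
    using form_nonneg common_neighbour_unique(2)[OF w] v(1) by (rule form_minimizer_eigen)
  also have "\<dots> = 0" using v by (simp add: diff_def)
  finally have "(\<Sum>x\<in>N v. nsum (diff w w') x / deg x) = 0" .
  moreover have "(\<Sum>x\<in>N v. nsum (diff w w') x / deg x)
      = (\<Sum>x\<in>N v. ((if x \<in> N w then 1 else 0) - (if x \<in> N w' then 1 else 0)) / real d)"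
    using v w by (intro sum.cong refl) (auto simp: nsum_diff regular dest: N_V)
  ultimately have "(\<Sum>x\<in>N v. (if x \<in> N w then 1 else 0) - (if x \<in> N w' then 1 else 0 :: real)) = 0"
    using d_ge_3 by (simp add: sum_divide_distrib[symmetric])
  then show ?thesis unfolding sum_subtractf cnt by simp
qed

section \<open>Classes of vertices with common neighbours\<close>

definition linked :: "'a \<Rightarrow> 'a \<Rightarrow> bool" where
  "linked v w \<longleftrightarrow> v = w \<or> N v \<inter> N w \<noteq> {}"

lemma linked_sym: "linked v w \<Longrightarrow> linked w v"
  by (auto simp: linked_def)

lemma linked_card:
  assumes "v \<in> V" "w \<in> V" "v \<noteq> w" "linked v w"
  shows "card (N v \<inter> N w) = 1"
  using assms common_neighbour_unique(1)[of v w] unfolding linked_def by fastforce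

text \<open>When \<open>w\<close> and \<open>w'\<close> share a neighbour, \<open>v\<close> has as
  many common neighbours with \<open>w\<close> as with \<open>w'\<close>, by
  \<open>common_neighbours_transfer\<close>.\<close>

lemma linked_trans:
  assumes V: "v \<in> V" "w \<in> V" "w' \<in> V" and l: "linked v w" "linked w w'"
  shows "linked v w'"
proof (cases "v = w \<or> v = w' \<or> w = w'")
  case True then show ?thesis using l by (auto simp: linked_def)
next
  case False
  then obtain u where "u \<in> N w" "u \<in> N w'" using l by (auto simp: linked_def)
  then have "card (N v \<inter> N w') = 1"
    using common_neighbours_transfer[of w w' u v] linked_card[of v w] False V l by auto
  then show ?thesis by (auto simp: linked_def)
qed

text \<open>With \<open>z\<close> a common neighbour of \<open>v\<close> and \<open>v'\<close>, the
  vertices \<open>x\<close> and \<open>z\<close> share \<open>v\<close>, while \<open>z\<close> and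
  \<open>x'\<close> share \<open>v'\<close>. Adjacency thus leads from one class into a single
  class.\<close>

lemma linked_neighbours:
  assumes V: "v \<in> V" "v' \<in> V" and x: "x \<in> N v" "x' \<in> N v'" and l: "linked v v'"
  shows "linked x x'"
proof -
  have same: "linked y y'" if "z \<in> V" "y \<in> N z" "y' \<in> N z" for y y' z
    using that N_sym unfolding linked_def by blast
  show ?thesis
  proof (cases "v = v'")
    case True then show ?thesis using same V x by blast
  next
    case False
    then obtain z where z: "z \<in> N v" "z \<in> N v'" using l by (auto simp: linked_def)
    have "linked x z" "linked z x'" using same V x z by blast+
    then show ?thesis using linked_trans[of x z x'] V x z N_V by blast
  qed
qed

text \<open>For an edge between \<open>a\<close> and \<open>b\<close>, neighbourhoods lead from the
  class of \<open>a\<close> into that of \<open>b\<close> and back. The union is closed under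
  neighbours, hence all of \<open>V\<close>, and two classes are disjoint or equal.\<close>

lemma friendship_or_bipartite:
  obtains (friendship) "\<And>v w. v \<in> V \<Longrightarrow> w \<in> V \<Longrightarrow> v \<noteq> w \<Longrightarrow> card (N v \<inter> N w) = 1"
  | (bipartite) P L where "P \<union> L = V" "P \<inter> L = {}"
    "\<And>v. v \<in> P \<Longrightarrow> N v \<subseteq> L" "\<And>v. v \<in> L \<Longrightarrow> N v \<subseteq> P" "P \<noteq> {}" "L \<noteq> {}"
    "\<And>v w. v \<in> P \<Longrightarrow> w \<in> P \<Longrightarrow> v \<noteq> w \<Longrightarrow> card (N v \<inter> N w) = 1"
    "\<And>v w. v \<in> L \<Longrightarrow> w \<in> L \<Longrightarrow> v \<noteq> w \<Longrightarrow> card (N v \<inter> N w) = 1"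
proof -
  obtain a where a: "a \<in> V" using V_nonempty by blast
  obtain b where b: "b \<in> N a" using N_nonempty[OF a] by blast
  have bV: "b \<in> V" "a \<in> N b" using a b N_V N_sym by blast+
  define P L where "P = {v \<in> V. linked v a}" and "L = {v \<in> V. linked v b}"
  have PL: "N v \<subseteq> L" if "v \<in> P" for v
    using that linked_neighbours[of v a] a b N_V unfolding P_def L_def by blast
  have LP: "N v \<subseteq> P" if "v \<in> L" for v
    using that linked_neighbours[of v b] bV N_V unfolding P_def L_def by blast
  have aP: "a \<in> P" "b \<in> L" using a bV by (auto simp: P_def L_def linked_def)
  have V: "P \<union> L = V"
    by (rule connected) (use PL LP aP in \<open>auto simp: P_def L_def\<close>)
  have cP: "card (N v \<inter> N w) = 1" if "v \<in> P" "w \<in> P" "v \<noteq> w" for v w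
    using that linked_trans[of v a w] linked_sym[of w a] a linked_card[of v w]
    unfolding P_def by blast
  have cL: "card (N v \<inter> N w) = 1" if "v \<in> L" "w \<in> L" "v \<noteq> w" for v w
    using that linked_trans[of v b w] linked_sym[of w b] bV linked_card[of v w]
    unfolding L_def by blast
  show thesis
  proof (cases "P \<inter> L = {}")
    case True
    show thesis by (rule bipartite[of P L]) (use True V PL LP cP cL aP in auto)
  next
    case False
    then obtain c where c: "c \<in> V" "linked c a" "linked c b" by (auto simp: P_def L_def)
    then have ab: "linked a b" using linked_trans[of a c b] linked_sym[of c a] a bV by blast
    have "L \<subseteq> P" using linked_trans[of _ b a] linked_sym[OF ab] a bV by (auto simp: P_def L_def)
    then have "P = V" using V by auto
    then show thesis using cP friendship by blast
  qed
qed

end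

end

text \<open>If \<open>r\<close> exceeded \<open>gap\<close>, the form at \<open>gap\<close> would be
  nonnegative as well and vanish on some \<open>diff w w'\<close>; since that function has positive
  mass, the form at \<open>r\<close> would be negative there.\<close>

lemma (in min_degree_graph) form_nonneg_le_gap:
  assumes "\<And>h. 0 \<le> form r h"
  shows "r \<le> gap"
proof (rule ccontr)
  assume "\<not> r \<le> gap"
  have nonneg: "0 \<le> form gap h" for h
  proof -
    have "form gap h = form r h + (r - gap) * mass h" by (simp add: form_def algebra_simps)
    then show ?thesis using assms[of h] mass_nonneg[of h] \<open>\<not> r \<le> gap\<close> by simp
  qed
  obtain u w w' where uw: "u \<in> V" "w \<in> N u" "w' \<in> N u" "w \<noteq> w'" "card (N w) = d" "card (N w') = d"
    using exists_degree_d_neighbours[OF nonneg] by blast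
  have "form r (diff w w') = form gap (diff w w') - (r - gap) * mass (diff w w')"
    by (simp add: form_def algebra_simps)
  also have "\<dots> < 0"
    using degree_d_neighbours(1)[OF nonneg uw] mass_diff_pos[of w w'] N_V[OF uw(2,1)] uw(4)
      \<open>\<not> r \<le> gap\<close> by simp
  finally show False using assms[of "diff w w'"] by simp
qed

section \<open>Regular friendship graphs\<close>

lemma sum_diag_mult_commute:
  fixes A B :: "'a :: comm_semiring_0 mat"
  assumes "A \<in> carrier_mat n n" "B \<in> carrier_mat n n"
  shows "(\<Sum>i<n. (A * B) $$ (i, i)) = (\<Sum>i<n. (B * A) $$ (i, i))"
proof -
  have "(\<Sum>i<n. (A * B) $$ (i, i)) = (\<Sum>i<n. \<Sum>j<n. A $$ (i, j) * B $$ (j, i))"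
    using assms by (auto simp: scalar_prod_def atLeast0LessThan intro!: sum.cong)
  also have "\<dots> = (\<Sum>j<n. \<Sum>i<n. A $$ (i, j) * B $$ (j, i))" by (rule sum.swap)
  also have "\<dots> = (\<Sum>i<n. (B * A) $$ (i, i))"
    using assms by (auto simp: scalar_prod_def atLeast0LessThan mult.commute intro!: sum.cong)
  finally show ?thesis .
qed

lemma sum_diag_similar:
  fixes A B :: "'a :: comm_ring_1 mat"
  assumes w: "similar_mat_wit A B P Q" and A: "A \<in> carrier_mat n n"
  shows "(\<Sum>i<n. A $$ (i, i)) = (\<Sum>i<n. B $$ (i, i))"
proof -
  note D = similar_mat_witD2[OF A w]
  have "(\<Sum>i<n. (P * B * Q) $$ (i, i)) = (\<Sum>i<n. (Q * (P * B)) $$ (i, i))"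
    using D by (intro sum_diag_mult_commute) auto
  also have "Q * (P * B) = (Q * P) * B" using D by (intro assoc_mult_mat[symmetric]) auto
  also have "\<dots> = B" using D by simp
  finally show ?thesis using D(3) by simp
qed

text \<open>The \<open>e i\<close> are the diagonal entries of a Schur form. Similarity preserves
  traces, and squaring a triangular matrix squares its diagonal entries.\<close>

lemma eigenvalues_sum_diag:
  fixes A :: "complex mat"
  assumes A: "A \<in> carrier_mat n n"
  obtains e where "\<And>i. i < n \<Longrightarrow> eigenvalue A (e i)"
    "(\<Sum>i<n. e i) = (\<Sum>i<n. A $$ (i, i))" "(\<Sum>i<n. (e i)\<^sup>2) = (\<Sum>i<n. (A * A) $$ (i, i))"
proof -
  obtain es where es: "char_poly A = (\<Prod>a\<leftarrow>es. [:- a, 1:])"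
    using char_poly_factorized[OF A] by blast
  obtain B P Q where "schur_decomposition A es = (B, P, Q)" by (metis prod_cases3)
  from schur_decomposition[OF A es this]
  have w: "similar_mat_wit A B P Q" and ut: "upper_triangular B" and dB: "diag_mat B = es"
    by auto
  have B: "B \<in> carrier_mat n n" using similar_mat_witD2[OF A w] by auto
  show thesis
  proof (rule that[of "\<lambda>i. B $$ (i, i)"])
    show "eigenvalue A (B $$ (i, i))" if i: "i < n" for i
    proof -
      have "B $$ (i, i) \<in> set es" using i B by (auto simp: dB[symmetric] diag_mat_def)
      then show ?thesis
        unfolding eigenvalue_root_char_poly[OF A] es poly_prod_list prod_list_zero_iff
        by (force simp: image_iff)
    qed
    show "(\<Sum>i<n. B $$ (i, i)) = (\<Sum>i<n. A $$ (i, i))"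
      using sum_diag_similar[OF w A] by simp
    have "similar_mat_wit (A ^\<^sub>m 2) (B ^\<^sub>m 2) P Q" by (rule similar_mat_wit_pow[OF w])
    then have w2: "similar_mat_wit (A * A) (B * B) P Q"
      using A B by (simp add: numeral_2_eq_2)
    have "(B * B) $$ (i, i) = (B $$ (i, i))\<^sup>2" if i: "i < n" for i
    proof -
      have "(B * B) $$ (i, i) = (\<Sum>j\<in>{..<n}. B $$ (i, j) * B $$ (j, i))"
        using B i by (auto simp: scalar_prod_def atLeast0LessThan)
      \<comment> \<open>For \<open>j \<noteq> i\<close> one of the two factors lies below the
        diagonal.\<close>
      also have "\<dots> = (\<Sum>j\<in>{i}. B $$ (i, j) * B $$ (j, i))"
      proof (rule sum.mono_neutral_right)
        show "\<forall>j\<in>{..<n} - {i}. B $$ (i, j) * B $$ (j, i) = 0"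
        proof
          fix j assume "j \<in> {..<n} - {i}"
          then have "j < i \<or> i < j" "j < n" by auto
          then show "B $$ (i, j) * B $$ (j, i) = 0"
            using ut B i unfolding upper_triangular_def by auto
        qed
      qed (use i in auto)
      finally show ?thesis by (simp add: power2_eq_square)
    qed
    then show "(\<Sum>i<n. (B $$ (i, i))\<^sup>2) = (\<Sum>i<n. (A * A) $$ (i, i))"
      using sum_diag_similar[OF w2 mult_carrier_mat[OF A A]] by (simp del: index_mult_mat(1))
  qed
qed

section \<open>Walks of length two and adjacency eigenvalues\<close>

context neighbourhood_graph
begin

text \<open>Double counting: walks of length two from \<open>v\<close> to \<open>w\<close>
  correspond to common neighbours, so both sides are the squared adjacency matrix applied to
  \<open>f\<close>.\<close>

lemma sum_paths:
  fixes f :: "'a \<Rightarrow> 'b :: comm_ring_1"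
  assumes v: "v \<in> V"
  shows "(\<Sum>x\<in>N v. \<Sum>w\<in>N x. f w) = (\<Sum>w\<in>V. of_nat (card (N v \<inter> N w)) * f w)"
proof -
  have "(\<Sum>x\<in>N v. \<Sum>w\<in>N x. f w) = (\<Sum>x\<in>N v. \<Sum>w\<in>V. if x \<in> N w then f w else 0)"
  proof (rule sum.cong[OF refl])
    fix x assume "x \<in> N v"
    then have x: "x \<in> V" using v N_V by blast
    show "(\<Sum>w\<in>N x. f w) = (\<Sum>w\<in>V. if x \<in> N w then f w else 0)"
      using N_subset[OF x] finite_V N_commute[OF x]
      by (intro sum.mono_neutral_cong_left) auto
  qed
  also have "\<dots> = (\<Sum>w\<in>V. \<Sum>x\<in>N v. if x \<in> N w then f w else 0)" by (rule sum.swap)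
  also have "\<dots> = (\<Sum>w\<in>V. of_nat (card (N v \<inter> N w)) * f w)"
    using v by (intro sum.cong refl) (simp add: sum.If_cases Int_def)
  finally show ?thesis .
qed

lemma eigenvalue_adjacency:
  assumes vs: "distinct vs" "set vs = V"
    and ev: "eigenvalue (mat (length vs) (length vs)
      (\<lambda>(i, j). if vs ! j \<in> N (vs ! i) then 1 else 0)) (e :: complex)" (is "eigenvalue ?A e")
  obtains f u where "u \<in> V" "f u \<noteq> 0" "\<And>v. v \<in> V \<Longrightarrow> (\<Sum>w\<in>N v. f w) = e * f v"
proof -
  let ?n = "length vs"
  have bij: "bij_betw (\<lambda>j. vs ! j) {0..<?n} V"
    using bij_betw_nth[OF vs(1)] vs(2) by (simp add: atLeast0LessThan)
  obtain x where x: "x \<in> carrier_vec ?n" "x \<noteq> 0\<^sub>v ?n" "?A *\<^sub>v x = e \<cdot>\<^sub>v x"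
    using ev by (auto simp: eigenvalue_def eigenvector_def)
  define f where "f v = x $ (the_inv_into {0..<?n} (\<lambda>j. vs ! j) v)" for v
  have f: "f (vs ! j) = x $ j" if "j < ?n" for j
    using that bij by (simp add: f_def bij_betw_def the_inv_into_f_f)
  obtain i where i: "i < ?n" "x $ i \<noteq> 0"
    using x(1,2) by (metis carrier_vecD eq_vecI index_zero_vec(1,2))
  show thesis
  proof (rule that[of "vs ! i" f])
    show "vs ! i \<in> V" using i vs by auto
    show "f (vs ! i) \<noteq> 0" using f i by simp
    fix v assume v: "v \<in> V"
    then obtain k where k: "k < ?n" "v = vs ! k" using vs by (metis in_set_conv_nth)
    have "e * f v = (?A *\<^sub>v x) $ k" using x k f by simp
    also have "\<dots> = (\<Sum>j = 0..<?n. if vs ! j \<in> N v then f (vs ! j) else 0)"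
      using k x(1) f by (auto simp: scalar_prod_def intro!: sum.cong)
    also have "\<dots> = (\<Sum>w\<in>V. if w \<in> N v then f w else 0)"
      by (rule sum.reindex_bij_betw[OF bij])
    also have "\<dots> = (\<Sum>w\<in>N v. f w)"
      using N_subset[OF v] finite_V by (intro sum.mono_neutral_cong_right) auto
    finally show "(\<Sum>w\<in>N v. f w) = e * f v" by simp
  qed
qed

text \<open>The eigenvalues of the adjacency matrix are \<open>d\<close>, which is simple, and \<open>\<plusminus>sqrt (d - 1)\<close>;
  since their sum vanishes, \<open>d - 1\<close> divides \<open>d\<^sup>2 = (d - 1) (d + 1) + 1\<close>.\<close>
lemma regular_friendship_degree:
  assumes ne: "V \<noteq> {}" and reg: "\<And>v. v \<in> V \<Longrightarrow> card (N v) = d" and d: "2 \<le> d"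
    and fr: "\<And>v w. v \<in> V \<Longrightarrow> w \<in> V \<Longrightarrow> v \<noteq> w \<Longrightarrow> card (N v \<inter> N w) = 1"
  shows "d = 2"
proof -
  obtain vs where vs: "set vs = V" "distinct vs" using finite_distinct_list[OF finite_V] by blast
  define n where "n = length vs"
  have n: "n = card V" using vs by (simp add: n_def distinct_card[symmetric])
  \<comment> \<open>The squared adjacency matrix is J + (d - 1) I, with J the all-ones
    matrix.\<close>
  have paths: "(\<Sum>x\<in>N v. \<Sum>w\<in>N x. f w) = (\<Sum>w\<in>V. f w) + (of_nat d - 1) * f v"
    if v: "v \<in> V" for v and f :: "'a \<Rightarrow> complex"
  proof -
    have "(\<Sum>w\<in>V. of_nat (card (N v \<inter> N w)) * f w)
        = (\<Sum>w\<in>V. f w + (if w = v then (of_nat d - 1) * f v else 0))"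
      using v reg fr by (intro sum.cong refl) (auto simp: algebra_simps)
    then show ?thesis using v finite_V by (simp add: sum_paths sum.distrib)
  qed
  obtain v where v: "v \<in> V" using ne by blast
  have "(\<Sum>x\<in>N v. \<Sum>w\<in>N x. 1 :: complex) = of_nat d * of_nat d"
    using reg v N_V by simp
  with paths[OF v, of "\<lambda>_. 1"] have "complex_of_nat (d * d + 1) = of_nat (n + d)"
    by (simp add: n algebra_simps)
  then have card_n: "d * d + 1 = n + d" by (simp only: of_nat_eq_iff)
  define A :: "complex mat" where
    "A = mat n n (\<lambda>(i, j). if vs ! j \<in> N (vs ! i) then 1 else 0)"
  have A: "A \<in> carrier_mat n n" by (simp add: A_def)
  have inV: "vs ! i \<in> V" if "i < n" for i using that vs by (auto simp: n_def)
  have bij: "bij_betw (\<lambda>j. vs ! j) {0..<n} V"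
    using bij_betw_nth[OF vs(2)] vs(1) by (simp add: atLeast0LessThan n_def)
  obtain e where e: "\<And>i. i < n \<Longrightarrow> eigenvalue A (e i)"
    and tr1: "(\<Sum>i<n. e i) = (\<Sum>i<n. A $$ (i, i))"
    and tr2: "(\<Sum>i<n. (e i)\<^sup>2) = (\<Sum>i<n. (A * A) $$ (i, i))"
    using eigenvalues_sum_diag[OF A] by blast
  have "(\<Sum>i<n. A $$ (i, i)) = 0" using inV N_irrefl by (intro sum.neutral) (auto simp: A_def)
  with tr1 have tr1: "(\<Sum>i<n. e i) = 0" by simp
  have "(A * A) $$ (i, i) = of_nat d" if i: "i < n" for i
  proof -
    have "(A * A) $$ (i, i) = (\<Sum>j = 0..<n. if vs ! j \<in> N (vs ! i) then 1 else 0)"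
      using i N_commute inV by (auto simp: A_def scalar_prod_def intro!: sum.cong)
    also have "\<dots> = (\<Sum>w\<in>V. if w \<in> N (vs ! i) then 1 else 0)"
      by (rule sum.reindex_bij_betw[OF bij])
    also have "\<dots> = of_nat (card (N (vs ! i)))"
      using N_subset[OF inV[OF i]] finite_V by (simp add: sum.If_cases Int_absorb1)
    finally show ?thesis using reg inV i by simp
  qed
  with tr2 have tr2: "(\<Sum>i<n. (e i)\<^sup>2) = of_nat n * of_nat d" by simp
  define s where "s = sqrt (real d - 1)"
  have s2: "s\<^sup>2 = real d - 1" using d by (simp add: s_def)
  \<comment> \<open>Applying \<open>paths\<close> to an eigenfunction shows that
    \<open>((e i)\<^sup>2 - (of_nat d - 1)) * f v\<close> does not depend on \<open>v\<close>:
    either the factor vanishes, or \<open>f\<close> is constant and the eigenvalue is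
    \<open>d\<close>. The sign of the root is kept as an integer so that these eigenvalues sum to an
    integer multiple of \<open>s\<close>.\<close>
  have ev: "e i = of_nat d \<or> (\<exists>z::int. e i = of_int z * of_real s \<and> (e i)\<^sup>2 = of_nat d - 1)"
    if i: "i < n" for i
  proof -
    obtain f u where f: "u \<in> V" "f u \<noteq> 0" "\<And>v. v \<in> V \<Longrightarrow> (\<Sum>w\<in>N v. f w) = e i * f v"
      using eigenvalue_adjacency[OF vs(2,1) e[OF i, unfolded A_def n_def]] by blast
    have eq: "((e i)\<^sup>2 - (of_nat d - 1)) * f v = (\<Sum>w\<in>V. f w)" if v: "v \<in> V" for v
    proof -
      have "(\<Sum>x\<in>N v. \<Sum>w\<in>N x. f w) = (\<Sum>x\<in>N v. e i * f x)"
        using v N_V f(3) by (intro sum.cong) auto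
      also have "\<dots> = (e i)\<^sup>2 * f v"
        using f(3)[OF v] by (simp add: sum_distrib_left[symmetric] power2_eq_square)
      finally show ?thesis using paths[OF v, of f] by (simp add: algebra_simps)
    qed
    show ?thesis
    proof (cases "(e i)\<^sup>2 = of_nat d - 1")
      case True
      then have "(e i)\<^sup>2 = (complex_of_real s)\<^sup>2"
        using s2 by (metis of_real_1 of_real_diff of_real_of_nat_eq of_real_power)
      then have "e i = of_int 1 * of_real s \<or> e i = of_int (- 1) * of_real s"
        by (simp add: power2_eq_iff)
      then show ?thesis using True by blast
    next
      case False
      then have const: "f v = f u" if "v \<in> V" for v
        using eq[OF that] eq[OF f(1)] by (metis mult_left_cancel right_minus_eq)
      have "(\<Sum>w\<in>N u. f w) = (\<Sum>w\<in>N u. f u)" using f(1) by (intro sum.cong refl const) (rule N_V)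
      then have "of_nat d * f u = e i * f u" using f(1) f(3)[OF f(1)] reg by auto
      then show ?thesis using f(2) by simp
    qed
  qed
  define K where "K = {i. i < n \<and> e i = of_nat d}"
  define M where "M = {i. i < n \<and> e i \<noteq> of_nat d}"
  have KM: "{..<n} = K \<union> M" "K \<inter> M = {}" "finite K" "finite M" by (auto simp: K_def M_def)
  have split: "(\<Sum>i<n. h i) = (\<Sum>i\<in>K. h i) + (\<Sum>i\<in>M. h i)" for h :: "nat \<Rightarrow> complex"
    unfolding KM(1) using KM by (intro sum.union_disjoint) auto
  have card: "card M + card K = n" using KM by (metis add.commute card_Un_disjoint card_lessThan)
  from ev have "\<forall>i\<in>M. \<exists>z::int. e i = of_int z * of_real s \<and> (e i)\<^sup>2 = of_nat d - 1"
    unfolding M_def by blast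
  then obtain z :: "nat \<Rightarrow> int" where
    z: "\<And>i. i \<in> M \<Longrightarrow> e i = of_int (z i) * of_real s"
      "\<And>i. i \<in> M \<Longrightarrow> (e i)\<^sup>2 = of_nat d - 1" by metis
  \<comment> \<open>The trace \<open>n * d\<close> of the square determines the multiplicity of
    \<open>d\<close>: it yields \<open>card K * (d\<^sup>2 - d + 1) = n\<close>, and
    \<open>n = d\<^sup>2 - d + 1\<close> by \<open>card_n\<close>. Terms are moved across so that
    the identities live in the naturals.\<close>
  have "(\<Sum>i<n. (e i)\<^sup>2) = of_nat (card K) * (of_nat d)\<^sup>2 + of_nat (card M) * (of_nat d - 1)"
    unfolding split using z(2) by (simp add: K_def)
  then have "complex_of_nat (n * d + card M) = of_nat (card K * (d * d) + card M * d)"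
    using tr2 by (simp add: power2_eq_square algebra_simps)
  then have "n * d + card M = card K * (d * d) + card M * d" by (simp only: of_nat_eq_iff)
  then have "card K * (d * d + 1) = card K * d + n"
    unfolding card[symmetric] by (simp add: algebra_simps)
  then have "card K * n = n" unfolding card_n by (simp add: algebra_simps)
  moreover have "0 < n" using ne n finite_V by (simp add: card_gt_0_iff)
  ultimately have "card K = 1" by simp
  then have "(\<Sum>i<n. e i) = of_nat d + of_int (\<Sum>i\<in>M. z i) * of_real s"
    unfolding split using z(1) by (simp add: K_def sum_distrib_right)
  with tr1 have "complex_of_real (real d + of_int (\<Sum>i\<in>M. z i) * s) = 0" by simp
  then have "real d = - of_int (\<Sum>i\<in>M. z i) * s" by (simp only: of_real_eq_0_iff)
  \<comment> \<open>Squaring removes the possibly irrational \<open>s\<close> and leaves an integer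
    equation.\<close>
  then have "(real d)\<^sup>2 = (of_int (\<Sum>i\<in>M. z i))\<^sup>2 * (real d - 1)"
    by (simp add: power_mult_distrib s2)
  then have "real_of_int ((int d)\<^sup>2) = of_int ((\<Sum>i\<in>M. z i)\<^sup>2 * (int d - 1))" by simp
  then have "(int d)\<^sup>2 = (\<Sum>i\<in>M. z i)\<^sup>2 * (int d - 1)" by (simp only: of_int_eq_iff)
  then have "int d - 1 dvd (int d)\<^sup>2" by simp
  moreover have "(int d)\<^sup>2 = (int d - 1) * (int d + 1) + 1"
    by (simp add: power2_eq_square algebra_simps)
  ultimately have "int d - 1 dvd 1" by (metis dvd_add_right_iff dvd_triv_left)
  then show ?thesis using d by (auto dest: zdvd_imp_le)
qed

end

section \<open>Projective planes\<close>

lemma exists_avoiding_two: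
  assumes "3 \<le> card A"
  shows "\<exists>z\<in>A. z \<noteq> x \<and> z \<noteq> y"
proof -
  have "\<not> A \<subseteq> {x, y}"
    using assms card_mono[of "{x, y}" A] card_insert_le_m1[of 2 "{y}" x] by fastforce
  then show ?thesis by blast
qed

context neighbourhood_graph
begin

text \<open>Points and lines with adjacency as incidence. The condition is symmetric in both
  classes, so duality is a swap of arguments; nondegeneracy will come from the degrees.\<close>

definition plane_partition :: "'a set \<Rightarrow> 'a set \<Rightarrow> bool" where
  "plane_partition P L \<longleftrightarrow> P \<union> L = V \<and> P \<inter> L = {} \<and>
     (\<forall>v\<in>P. N v \<subseteq> L) \<and> (\<forall>v\<in>L. N v \<subseteq> P) \<and>
     (\<forall>v\<in>P. \<forall>w\<in>P. v \<noteq> w \<longrightarrow> card (N v \<inter> N w) = 1) \<and>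
     (\<forall>v\<in>L. \<forall>w\<in>L. v \<noteq> w \<longrightarrow> card (N v \<inter> N w) = 1)"

lemma plane_partition_sym: "plane_partition P L \<Longrightarrow> plane_partition L P"
  by (simp add: plane_partition_def Un_commute Int_commute)

lemma plane_partitionD:
  assumes "plane_partition P L"
  shows "v \<in> P \<Longrightarrow> v \<in> V" "v \<in> L \<Longrightarrow> v \<in> V" "v \<in> P \<Longrightarrow> v \<notin> L"
    "v \<in> P \<Longrightarrow> x \<in> N v \<Longrightarrow> x \<in> L" "v \<in> L \<Longrightarrow> x \<in> N v \<Longrightarrow> x \<in> P"
    "v \<in> V \<Longrightarrow> v \<in> P \<or> v \<in> L"
  using assms by (auto simp: plane_partition_def)

lemma plane_partition_common:
  assumes "plane_partition P L" "v \<in> P" "w \<in> P" "v \<noteq> w"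
  obtains x where "N v \<inter> N w = {x}"
proof -
  have "card (N v \<inter> N w) = 1" using assms by (simp add: plane_partition_def)
  then show thesis by (rule card_1_singletonE) (rule that)
qed

lemma plane_partition_unique:
  assumes "plane_partition P L" "v \<in> P" "w \<in> P" "v \<noteq> w"
    "x \<in> N v" "x \<in> N w" "y \<in> N v" "y \<in> N w"
  shows "x = y"
proof -
  obtain z where "N v \<inter> N w = {z}" by (rule plane_partition_common[OF assms(1-4)])
  moreover have "x \<in> N v \<inter> N w" "y \<in> N v \<inter> N w" using assms(5-) by auto
  ultimately show ?thesis by simp
qed

text \<open>Each line through the point \<open>v\<close> is sent to its intersection with the line
  \<open>w\<close>. As \<open>w\<close> misses \<open>v\<close>, that intersection differs from
  \<open>v\<close>, and together they determine the line, so the map is injective.\<close>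

lemma plane_partition_card_le:
  assumes pl: "plane_partition P L" and v: "v \<in> P" "w \<in> L" "w \<notin> N v"
  shows "card (N v) \<le> card (N w)"
proof -
  note D = plane_partitionD[OF pl]
  have "\<exists>x. x \<in> N y \<and> x \<in> N w" if "y \<in> N v" for y
  proof -
    have "y \<in> L" "y \<noteq> w" using that v D by metis+
    then show ?thesis
      using plane_partition_common[OF plane_partition_sym[OF pl], of y w] v by blast
  qed
  then obtain g where g: "\<And>y. y \<in> N v \<Longrightarrow> g y \<in> N y \<and> g y \<in> N w" by metis
  have V: "v \<in> V" "w \<in> V" using v D by metis+
  have "inj_on g (N v)"
  proof (rule inj_onI)
    fix y y' assume y: "y \<in> N v" "y' \<in> N v" "g y = g y'"
    then have "y \<in> N (g y)" "y' \<in> N (g y)"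
      using g V N_V N_sym by (metis)+
    moreover have "g y \<in> P" "g y \<noteq> v" using g y v D N_sym[of w v] V by metis+
    ultimately show "y = y'"
      using plane_partition_unique[OF pl, of "g y" v] v y by blast
  qed
  moreover have "g ` N v \<subseteq> N w" using g by blast
  ultimately show ?thesis using V by (intro card_inj_on_le) auto
qed

lemma plane_partition_card_eq:
  assumes pl: "plane_partition P L" and v: "v \<in> P" "w \<in> L" "w \<notin> N v"
  shows "card (N v) = card (N w)"
proof (rule antisym)
  show "card (N v) \<le> card (N w)" by (rule plane_partition_card_le[OF assms])
  have "v \<notin> N w" using v N_sym[of w v] plane_partitionD[OF pl] by metis
  then show "card (N w) \<le> card (N v)"
    using plane_partition_card_le[OF plane_partition_sym[OF pl]] v by blast
qed

text \<open>By \<open>plane_partition_card_eq\<close> a point and a line missing it have equal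
  degrees. Two lines are compared through a point off both, and a point is compared with a line that
  misses it.\<close>

lemma plane_partition_regular:
  assumes pl: "plane_partition P L" and l: "l \<in> L" "card (N l) = d"
    and deg3: "\<And>v. v \<in> V \<Longrightarrow> 3 \<le> card (N v)" and v: "v \<in> V"
  shows "card (N v) = d"
proof -
  note D = plane_partitionD[OF pl] and pl' = plane_partition_sym[OF pl]
  have avoid: "\<exists>z\<in>N v. z \<noteq> x \<and> z \<noteq> y" if "v \<in> V" for v x y
    using deg3[OF that] by (intro exists_avoiding_two) simp
  have lines: "card (N m) = d" if m: "m \<in> L" for m
  proof (cases "m = l")
    case False
    obtain x where x: "N m \<inter> N l = {x}" using plane_partition_common[OF pl' m l(1) False] .
    then have xm: "x \<in> N m" "x \<in> N l" by blast+
    then have xP: "x \<in> P" "x \<in> V" using m D by metis+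
    \<comment> \<open>A third line through the intersection point \<open>x\<close> supplies the
      point \<open>y\<close> off both \<open>m\<close> and \<open>l\<close>.\<close>
    obtain k where k: "k \<in> N x" "k \<noteq> m" "k \<noteq> l" using avoid[of x m l] xP by blast
    have kL: "k \<in> L" "k \<in> V" using k xP D by metis+
    obtain y where y: "y \<in> N k" "y \<noteq> x" using avoid[of k x x] kL by blast
    have yP: "y \<in> P" using y kL D by metis
    have off: "m' \<notin> N y" if "m' \<in> L" "k \<noteq> m'" "x \<in> N m'" for m'
      using plane_partition_unique[OF pl' kL(1) that(1,2), of x y]
        that y k xP yP D(1) N_sym by metis
    have "card (N y) = card (N m)" "card (N y) = card (N l)"
      using plane_partition_card_eq[OF pl yP] off xm m l k by metis+
    then show ?thesis using l by simp
  qed (use l in simp)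
  show ?thesis
  proof (cases "v \<in> L")
    case True then show ?thesis using lines by blast
  next
    case False
    then have vP: "v \<in> P" using v D by metis
    obtain k where k: "k \<in> N v" using avoid[OF v] by blast
    have kL: "k \<in> L" "k \<in> V" using k vP D by metis+
    obtain q where q: "q \<in> N k" "q \<noteq> v" using avoid[of k v v] kL by blast
    have qP: "q \<in> P" "q \<in> V" using q kL D by metis+
    \<comment> \<open>The only line joining \<open>q\<close> and \<open>v\<close> is
      \<open>k\<close>, so a second line through \<open>q\<close> misses \<open>v\<close>.\<close>
    obtain m where m: "m \<in> N q" "m \<noteq> k" using avoid[of q k k] qP by blast
    have mL: "m \<in> L" using m qP D by metis
    have "k \<in> N q" using q kL N_sym by metis
    then have "m \<notin> N v" using plane_partition_unique[OF pl qP(1) vP q(2), of k m] k m by blast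
    then show ?thesis using plane_partition_card_eq[OF pl vP mL] lines[OF mL] by simp
  qed
qed

text \<open>The quadrangle consists of two points on each of two lines \<open>l\<close>,
  \<open>m\<close>, all different from the intersection \<open>x\<close>.\<close>

lemma plane_partition_projective_plane:
  assumes pl: "plane_partition P L" and reg: "\<And>v. v \<in> V \<Longrightarrow> card (N v) = d"
    and d: "3 \<le> d" and ne: "V \<noteq> {}"
  shows "finite_projective_plane P L (\<lambda>p l. l \<in> N p) (d - 1)"
proof -
  note D = plane_partitionD[OF pl] and pl' = plane_partition_sym[OF pl]
  have other: "\<exists>z\<in>N v. z \<noteq> x \<and> z \<noteq> y" if "v \<in> V" for v x y
    using reg[OF that] d by (intro exists_avoiding_two) simp
  obtain l where l: "l \<in> L" "l \<in> V"
  proof -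
    obtain v where "v \<in> V" using ne by blast
    moreover obtain x where "x \<in> N v" using N_nonempty calculation by blast
    ultimately show thesis using that D N_V by metis
  qed
  obtain x where x: "x \<in> N l" using other[OF l(2)] by blast
  have xP: "x \<in> P" "x \<in> V" "l \<in> N x" using x l D N_sym by metis+
  obtain m where m: "m \<in> N x" "m \<noteq> l" using other[OF xP(2)] by blast
  have mL: "m \<in> L" "m \<in> V" "x \<in> N m" using m xP D N_sym by metis+
  obtain a where a: "a \<in> N l" "a \<noteq> x" using other[OF l(2)] by blast
  obtain b where b: "b \<in> N l" "b \<noteq> x" "b \<noteq> a" using other[OF l(2)] by blast
  obtain a' where a': "a' \<in> N m" "a' \<noteq> x" using other[OF mL(2)] by blast
  obtain b' where b': "b' \<in> N m" "b' \<noteq> x" "b' \<noteq> a'" using other[OF mL(2)] by blast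
  have disj: "p \<noteq> q" if "p \<in> N l" "p \<noteq> x" "q \<in> N m" for p q
    using plane_partition_unique[OF pl' l(1) mL(1), of x p] that x mL m by blast
  have inP: "a \<in> P" "b \<in> P" "a' \<in> P" "b' \<in> P" using a b a' b' l mL D by metis+
  have col_l: "k = l" if "k \<in> L" "k \<in> N a" "k \<in> N b" for k
    using plane_partition_unique[OF pl inP(1,2), of k l] that a b l N_sym by metis
  have col_m: "k = m" if "k \<in> L" "k \<in> N a'" "k \<in> N b'" for k
    using plane_partition_unique[OF pl inP(3,4), of k m] that a' b' mL N_sym by metis
  have notl: "l \<notin> N a'" "l \<notin> N b'" "m \<notin> N a" "m \<notin> N b"
    using disj[of a' a'] disj[of b' b'] disj[of a a] disj[of b b] a b a' b' inP D(1) N_sym by metis+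
  have quad: "\<exists>S\<subseteq>P. card S = 4 \<and> (\<forall>T\<subseteq>S. card T = 3 \<longrightarrow> \<not> (\<exists>k\<in>L. \<forall>p\<in>T. k \<in> N p))"
  proof (intro exI[of _ "{a, b, a', b'}"] conjI allI impI notI)
    have dist: "a \<noteq> a'" "a \<noteq> b'" "b \<noteq> a'" "b \<noteq> b'" using disj a b a' b' by blast+
    then show card4: "card {a, b, a', b'} = 4" using b(3) b'(3) by auto
    fix T assume T: "T \<subseteq> {a, b, a', b'}" "card T = 3" "\<exists>k\<in>L. \<forall>p\<in>T. k \<in> N p"
    then obtain k where k: "k \<in> L" "\<forall>p\<in>T. k \<in> N p" by blast
    \<comment> \<open>A triple omits one of the four points, so it contains a full pair on
      \<open>l\<close> or \<open>m\<close>; that pair determines the line, which misses the third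
      point.\<close>
    have "card ({a, b, a', b'} - T) = 1"
      using T card4 by (subst card_Diff_subset) (auto intro: finite_subset)
    then obtain z where "{a, b, a', b'} - T = {z}" by (rule card_1_singletonE)
    then have "p \<in> T \<or> p = z" if "p \<in> {a, b, a', b'}" for p using that by blast
    from this[of a] this[of b] this[of a'] this[of b']
    have "{a, b, a'} \<subseteq> T \<or> {a, b, b'} \<subseteq> T \<or> {a', b', a} \<subseteq> T \<or> {a', b', b} \<subseteq> T"
      using dist b(3) b'(3) by auto
    then show False using k col_l[OF k(1)] col_m[OF k(1)] notl unfolding insert_subset by metis
  qed (use inP in auto)
  have line: "\<exists>l\<in>L. card {p \<in> P. l \<in> N p} = d - 1 + 1"
  proof
    have "p \<in> P \<and> l \<in> N p \<longleftrightarrow> p \<in> N l" for p using l D N_sym by metis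
    then have "{p \<in> P. l \<in> N p} = N l" by blast
    then show "card {p \<in> P. l \<in> N p} = d - 1 + 1" using reg l d by simp
  qed (rule l)
  have join: "\<exists>!k. k \<in> L \<and> k \<in> N p \<and> k \<in> N q" if pq: "p \<in> P" "q \<in> P" "p \<noteq> q" for p q
  proof -
    obtain z where z: "N p \<inter> N q = {z}" using plane_partition_common[OF pl pq] .
    have "k \<in> L \<and> k \<in> N p \<and> k \<in> N q \<longleftrightarrow> k \<in> N p \<inter> N q" for k
      using D(4)[OF pq(1)] by blast
    then show ?thesis unfolding z by simp
  qed
  have meet: "\<exists>!p. p \<in> P \<and> k \<in> N p \<and> k' \<in> N p" if k: "k \<in> L" "k' \<in> L" "k \<noteq> k'" for k k'
  proof -
    obtain z where z: "N k \<inter> N k' = {z}" using plane_partition_common[OF pl' k] .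
    have "p \<in> P \<and> k \<in> N p \<and> k' \<in> N p \<longleftrightarrow> p \<in> N k \<inter> N k'" for p
      using k D N_sym unfolding Int_iff by metis
    then show ?thesis unfolding z by simp
  qed
  have "finite P" "finite L" using finite_V pl unfolding plane_partition_def by auto
  then show ?thesis unfolding finite_projective_plane_def
    using d by (intro conjI ballI impI join meet quad line) simp_all
qed

section \<open>Eigenvalues of the incidence graph of a plane\<close>

lemma plane_partition_sum_paths:
  fixes f :: "'a \<Rightarrow> complex"
  assumes pl: "plane_partition P L" and v: "v \<in> P" and reg: "card (N v) = d"
  shows "(\<Sum>x\<in>N v. \<Sum>w\<in>N x. f w) = (\<Sum>w\<in>P. f w) + (of_nat d - 1) * f v"
proof -
  note D = plane_partitionD[OF pl]
  have P: "P \<subseteq> V" "finite P" using finite_V pl unfolding plane_partition_def by auto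
  have "(\<Sum>w\<in>V. of_nat (card (N v \<inter> N w)) * f w) = (\<Sum>w\<in>P. of_nat (card (N v \<inter> N w)) * f w)"
  proof (rule sum.mono_neutral_right)
    show "\<forall>w\<in>V - P. of_nat (card (N v \<inter> N w)) * f w = 0"
    proof
      fix w assume "w \<in> V - P"
      then have "N v \<subseteq> L" "N w \<subseteq> P" using v pl unfolding plane_partition_def by blast+
      then have "N v \<inter> N w = {}" using pl unfolding plane_partition_def by blast
      then show "of_nat (card (N v \<inter> N w)) * f w = 0" by simp
    qed
  qed (use finite_V P in auto)
  also have "\<dots> = (\<Sum>w\<in>P. f w + (if w = v then (of_nat d - 1) * f v else 0))"
    using v reg pl unfolding plane_partition_def
    by (intro sum.cong refl) (auto simp: algebra_simps)
  finally show ?thesis using v P by (simp add: sum_paths[OF D(1)[OF v]] sum.distrib)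
qed

text \<open>On each class the squared adjacency matrix acts as J + (d - 1) I. Either the eigenvalue
  has the critical modulus, or \<open>f\<close> is constant on each class; then going to a neighbour
  and back gives \<open>\<mu>\<^sup>2 = 1\<close>, and one exceeds the bound.\<close>

lemma plane_partition_eigenvalue:
  assumes pl: "plane_partition P L" and reg: "\<And>v. v \<in> V \<Longrightarrow> card (N v) = d" and d: "1 \<le> d"
    and u: "u \<in> V" "f u \<noteq> 0"
    and ev: "\<And>v. v \<in> V \<Longrightarrow> (\<Sum>w\<in>N v. f w) = of_nat d * \<mu> * f v"
  shows "sqrt (real d - 1) / real d \<le> cmod \<mu>"
proof (cases "(of_nat d * \<mu>)\<^sup>2 = of_nat d - 1")
  case True
  have "(real d * cmod \<mu>)\<^sup>2 = cmod (of_nat d - 1)"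
    by (metis True norm_mult norm_of_nat norm_power)
  also have "\<dots> = real d - 1"
    using d by (metis norm_of_nat of_nat_1 of_nat_diff)
  finally have "sqrt (real d - 1) = real d * cmod \<mu>"
    by (metis norm_ge_zero of_nat_0_le_iff real_sqrt_unique zero_le_mult_iff)
  then show ?thesis using d by simp
next
  case False
  \<comment> \<open>Stated for an arbitrary partition so that it also serves with the two classes
    exchanged.\<close>
  have const: "f v = f w" if pl: "plane_partition P L" and vw: "v \<in> P" "w \<in> P" for P L v w
  proof -
    note D = plane_partitionD[OF pl]
    have eq: "((of_nat d * \<mu>)\<^sup>2 - (of_nat d - 1)) * f v = (\<Sum>w\<in>P. f w)" if v: "v \<in> P" for v
    proof -
      have "(\<Sum>x\<in>N v. \<Sum>w\<in>N x. f w) = (\<Sum>x\<in>N v. of_nat d * \<mu> * f x)"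
        using N_V[OF _ D(1)[OF v]] by (intro sum.cong refl ev)
      also have "\<dots> = (of_nat d * \<mu>)\<^sup>2 * f v"
        using ev[OF D(1)[OF v]] by (simp add: sum_distrib_left[symmetric] power2_eq_square)
      finally show ?thesis
        using plane_partition_sum_paths[OF pl v reg[OF D(1)[OF v]], of f]
        by (simp add: algebra_simps)
    qed
    show ?thesis using eq[OF vw(1)] eq[OF vw(2)] False by (metis mult_left_cancel right_minus_eq)
  qed
  have step: "f x = \<mu> * f v" if pl: "plane_partition P L" and v: "v \<in> P" "x \<in> N v" for P L v x
  proof -
    note D = plane_partitionD[OF pl]
    have "(\<Sum>w\<in>N v. f w) = (\<Sum>w\<in>N v. f x)"
      using v by (intro sum.cong refl const[OF plane_partition_sym[OF pl]]) (use D(4)[OF v(1)] v in auto)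
    then have "of_nat d * f x = of_nat d * (\<mu> * f v)"
      using ev[OF D(1)[OF v(1)]] reg[OF D(1)[OF v(1)]] by (auto simp: mult.assoc)
    then show ?thesis using d by simp
  qed
  obtain x where x: "x \<in> N u" using N_nonempty u by blast
  then have xu: "x \<in> V" "u \<in> N x" using u N_V N_sym by metis+
  have "f x = \<mu> * f u" "f u = \<mu> * f x"
    using step[OF pl] step[OF plane_partition_sym[OF pl]] plane_partitionD(6)[OF pl] x xu u by metis+
  then have "f u = \<mu>\<^sup>2 * f u" by (simp add: power2_eq_square mult.assoc)
  then have "\<mu>\<^sup>2 = 1" using u by simp
  then have "(cmod \<mu>)\<^sup>2 = 1" by (metis norm_one norm_power)
  then have "cmod \<mu> = 1" using norm_ge_zero[of \<mu>] unfolding power2_eq_1_iff by linarith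
  moreover have "real d * 1 \<le> real d * real d" using d by (intro mult_left_mono) auto
  then have "sqrt (real d - 1) \<le> real d" by (intro real_le_lsqrt) (auto simp: power2_eq_square)
  ultimately show ?thesis using d by simp
qed

end

lemma (in min_degree_graph) plane_partition_of_form_nonneg:
  assumes "\<And>h. 0 \<le> form gap h"
  obtains P L where "plane_partition P L"
  using assms
proof (cases rule: friendship_or_bipartite)
  case friendship
  have "d = 2"
    by (rule regular_friendship_degree[OF V_nonempty regular[OF assms] _ friendship])
      (use d_ge_3 in auto)
  then show thesis using d_ge_3 by simp
next
  case (bipartite P L)
  then show thesis by (intro that[of P L]) (simp add: plane_partition_def)
qed

section \<open>The normalized Laplacian of a graph\<close>

abbreviation neighbours :: "'a pair_pre_digraph \<Rightarrow> 'a \<Rightarrow> 'a set" where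
  "neighbours G v \<equiv> {w. (v, w) \<in> parcs G}"

context pair_graph
begin

lemma sym_parcs: "(v, w) \<in> parcs G \<Longrightarrow> (w, v) \<in> parcs G"
  using pair_sym_arcs by (auto simp: symmetric_def dest: symD)

lemma out_degree_eq_card: "out_degree (with_proj G) v = card (neighbours G v)"
proof -
  have "out_arcs (with_proj G) v = Pair v ` neighbours G v" by (auto simp: out_arcs_def)
  then show ?thesis by (simp add: out_degree_def card_image inj_on_def)
qed

text \<open>A connected symmetric digraph is strongly connected, so a nonempty set closed under
  neighbours absorbs every vertex by induction on reachability.\<close>

lemma min_degree_graph_neighbours:
  assumes d: "3 \<le> d" and conn: "Digraph_Component.connected (with_proj G)"
    and deg: "\<And>v. v \<in> pverts G \<Longrightarrow> d \<le> out_degree (with_proj G) v"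
  shows "min_degree_graph (pverts G) (neighbours G) d"
proof
  show "finite (pverts G)" by (rule pair_finite_verts)
  show "neighbours G v \<subseteq> pverts G" for v using in_arcsD2 by blast
  show "w \<in> neighbours G v \<Longrightarrow> v \<in> neighbours G w" for v w using sym_parcs by blast
  show "v \<notin> neighbours G v" for v using pair_no_loops by fastforce
  have sc: "strongly_connected (with_proj G)"
    using conn pair_sym_arcs by (intro symmetric_connected_imp_strongly_connected)
  show ne: "pverts G \<noteq> {}" using sc by (auto simp: strongly_connected_def)
  show "d \<le> card (neighbours G v)" if "v \<in> pverts G" for v
    using deg[OF that] out_degree_eq_card by simp
  then show "neighbours G v \<noteq> {}" if "v \<in> pverts G" for v using d that by fastforce
  show "3 \<le> d" by (rule d)
  fix S assume S: "S \<subseteq> pverts G" "S \<noteq> {}" and cl: "\<And>v. v \<in> S \<Longrightarrow> neighbours G v \<subseteq> S"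
  obtain s where s: "s \<in> S" using S by blast
  have "v \<in> S" if "v \<in> pverts G" for v
  proof -
    have "s \<rightarrow>\<^sup>*\<^bsub>with_proj G\<^esub> v" using sc s S that by (auto simp: strongly_connected_def)
    then show ?thesis
    proof (induction rule: reachable_induct)
      case base show ?case by (rule s)
    next
      case (step x y) then show ?case using cl by auto
    qed
  qed
  then show "S = pverts G" using S by blast
qed

lemma normalized_laplacian_carrier:
  "normalized_laplacian G vs \<in> carrier_mat (length vs) (length vs)"
  unfolding normalized_laplacian_def
  by (rule minus_carrier_mat, rule mult_carrier_mat[where n = "length vs"])
    (simp_all add: degree_matrix_inv_def adjacency_matrix_def)

text \<open>Since L = I - D^-1 A, an eigenvalue \<open>c\<close> of D^-1 A gives
  \<open>1 - c\<close> for L; the eigenvector lists the function along \<open>vs\<close>.\<close>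

lemma normalized_laplacian_eigenvalueI:
  assumes vs: "distinct vs" "set vs = pverts G" and u: "u \<in> pverts G" "f u \<noteq> 0"
    and pos: "\<And>v. v \<in> pverts G \<Longrightarrow> 0 < card (neighbours G v)"
    and ev: "\<And>v. v \<in> pverts G \<Longrightarrow> (\<Sum>w\<in>neighbours G v. f w) = c * of_nat (card (neighbours G v)) * f v"
  shows "1 - c \<in> spectrum (normalized_laplacian G vs)"
proof -
  let ?n = "length vs" and ?L = "normalized_laplacian G vs"
  let ?x = "vec ?n (\<lambda>j. f (vs ! j))"
  have dim: "dim_row ?L = ?n" using normalized_laplacian_carrier by auto
  have "?L *\<^sub>v ?x = (1 - c) \<cdot>\<^sub>v ?x"
  proof (rule eq_vecI)
    fix i assume "i < dim_vec ((1 - c) \<cdot>\<^sub>v ?x)"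
    then have i: "i < ?n" by simp
    then have iV: "vs ! i \<in> pverts G" using vs(2) nth_mem by blast
    have "(?L *\<^sub>v ?x) $ i = f (vs ! i) - c * f (vs ! i)"
      using normalized_laplacian_mult_vec[OF pair_graph_axioms vs i, of f] ev[OF iV] pos[OF iV]
      by (simp add: out_degree_eq_card)
    then show "(?L *\<^sub>v ?x) $ i = ((1 - c) \<cdot>\<^sub>v ?x) $ i" using i by (simp add: algebra_simps)
  qed (simp add: dim)
  moreover have "?x \<noteq> 0\<^sub>v ?n"
  proof
    assume eq: "?x = 0\<^sub>v ?n"
    obtain k where k: "k < ?n" "vs ! k = u" using u vs by (metis in_set_conv_nth)
    then have "?x $ k = f u" by simp
    with eq k u show False by simp
  qed
  ultimately have "eigenvector ?L ?x (1 - c)" by (simp add: eigenvector_def dim)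
  then show ?thesis by (auto simp: spectrum_def eigenvalue_def)
qed

lemma normalized_laplacian_eigenvalueE:
  assumes vs: "distinct vs" "set vs = pverts G"
    and pos: "\<And>v. v \<in> pverts G \<Longrightarrow> 0 < card (neighbours G v)"
    and ev: "c \<in> spectrum (normalized_laplacian G vs)"
  obtains f u where "u \<in> pverts G" "f u \<noteq> 0"
    "\<And>v. v \<in> pverts G \<Longrightarrow> (\<Sum>w\<in>neighbours G v. f w) = of_nat (card (neighbours G v)) * (1 - c) * f v"
proof -
  let ?n = "length vs" and ?L = "normalized_laplacian G vs"
  have dim: "dim_row ?L = ?n" using normalized_laplacian_carrier by auto
  have bij: "bij_betw (\<lambda>j. vs ! j) {0..<?n} (pverts G)"
    using bij_betw_nth[OF vs(1)] vs(2) by (simp add: atLeast0LessThan)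
  obtain x where x: "x \<in> carrier_vec ?n" "x \<noteq> 0\<^sub>v ?n" "?L *\<^sub>v x = c \<cdot>\<^sub>v x"
    using ev by (auto simp: spectrum_def eigenvalue_def eigenvector_def dim)
  define f where "f v = x $ (the_inv_into {0..<?n} (\<lambda>j. vs ! j) v)" for v
  have f: "f (vs ! j) = x $ j" if "j < ?n" for j
    using that bij by (simp add: f_def bij_betw_def the_inv_into_f_f)
  have xf: "x = vec ?n (\<lambda>j. f (vs ! j))" using x(1) f by (intro eq_vecI) auto
  obtain i where i: "i < ?n" "x $ i \<noteq> 0"
    using x(1,2) by (metis carrier_vecD eq_vecI index_zero_vec(1,2))
  show thesis
  proof (rule that[of "vs ! i" f])
    show "vs ! i \<in> pverts G" using i(1) vs(2) nth_mem by blast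
    show "f (vs ! i) \<noteq> 0" using f i by simp
    fix v assume v: "v \<in> pverts G"
    then obtain k where k: "k < ?n" "v = vs ! k" using vs by (metis in_set_conv_nth)
    have "c * f v = (?L *\<^sub>v x) $ k" using x k f by simp
    also have "\<dots> = f v - 1 / of_nat (card (neighbours G v)) * (\<Sum>w\<in>neighbours G v. f w)"
      using normalized_laplacian_mult_vec[OF pair_graph_axioms vs k(1), of f] k(2) xf
      by (simp add: out_degree_eq_card)
    finally show "(\<Sum>w\<in>neighbours G v. f w) = of_nat (card (neighbours G v)) * (1 - c) * f v"
      using pos[OF v] by (simp add: field_simps)
  qed
qed

section \<open>Partitions versus isomorphisms with incidence graphs\<close>

lemma digraph_iso_incidence_graph:
  assumes PL: "P \<union> L = pverts G" "P \<inter> L = {}"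
    and P: "\<And>v. v \<in> P \<Longrightarrow> neighbours G v \<subseteq> L" and L: "\<And>v. v \<in> L \<Longrightarrow> neighbours G v \<subseteq> P"
  shows "digraph_iso (with_proj G) (with_proj (incidence_graph P L (\<lambda>p l. l \<in> neighbours G p)))"
    (is "digraph_iso _ (with_proj ?I)")
proof -
  define h :: "'a \<Rightarrow> 'a + 'a" where "h x = (if x \<in> P then Inl x else Inr x)" for x
  define hom where "hom = \<lparr> iso_verts = h, iso_arcs = map_prod h h,
    iso_head = snd, iso_tail = fst \<rparr>"
  have hP: "h x = Inl x" if "x \<in> P" for x using that by (simp add: h_def)
  have hL: "h x = Inr x" if "x \<in> L" for x using that PL by (auto simp: h_def)
  have inj: "inj h" by (auto simp: inj_on_def h_def split: if_splits)
  have "pre_digraph.digraph_isomorphism (with_proj G) hom"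
    unfolding pre_digraph.digraph_isomorphism_def
    using wf_digraph_axioms inj_on_subset[OF inj] inj_on_subset[OF prod.inj_map[OF inj inj]]
    by (auto simp: hom_def)
  moreover have "with_proj ?I = app_iso hom (with_proj G)"
  proof -
    have "h ` pverts G = P <+> L"
      unfolding PL(1)[symmetric] image_Un Plus_def using hP hL by simp
    moreover have "map_prod h h ` parcs G = parcs ?I"
    proof (rule Set.set_eqI, rule iffI)
      fix e assume "e \<in> map_prod h h ` parcs G"
      then obtain x y where xy: "(x, y) \<in> parcs G" "e = (h x, h y)" by auto
      then have "x \<in> P \<or> x \<in> L" using PL(1) in_arcsD1 by blast
      then show "e \<in> parcs ?I"
      proof
        assume x: "x \<in> P"
        then have "y \<in> L" using P xy by blast
        then show ?thesis using x xy hP hL by (auto simp: incidence_graph_def)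
      next
        assume x: "x \<in> L"
        then have "y \<in> P" using L xy by blast
        then show ?thesis using x xy hP hL sym_parcs by (auto simp: incidence_graph_def)
      qed
    next
      fix e assume "e \<in> parcs ?I"
      then obtain p l where pl: "p \<in> P" "l \<in> L" "(p, l) \<in> parcs G"
        and e: "e = (Inl p, Inr l) \<or> e = (Inr l, Inl p)"
        by (auto simp: incidence_graph_def)
      then have "e = map_prod h h (p, l) \<or> e = map_prod h h (l, p)" using hP hL by simp
      then show "e \<in> map_prod h h ` parcs G" using pl(3) sym_parcs by blast
    qed
    ultimately show ?thesis
      by (simp add: app_iso_def hom_def with_proj_def incidence_graph_def)
  qed
  ultimately show ?thesis unfolding digraph_iso_def by blast
qed

text \<open>Points and lines are pulled back along the isomorphism. Injectivity carries over the
  sizes of intersections, and the line with \<open>n + 1\<close> points is kept to fix the common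
  degree later.\<close>

lemma incidence_graph_iso_partition:
  assumes ng: "neighbourhood_graph (pverts G) (neighbours G)"
    and pg: "is_plane_incidence_graph G n"
  obtains P L l where "neighbourhood_graph.plane_partition (pverts G) (neighbours G) P L"
    "l \<in> L" "card (neighbours G l) = n + 1"
proof -
  interpret neighbourhood_graph "pverts G" "neighbours G" by (rule ng)
  obtain P0 L0 :: "nat set" and inc f where plane: "finite_projective_plane P0 L0 inc n"
    and iso: "pre_digraph.digraph_isomorphism (with_proj G) f"
    and app: "with_proj (incidence_graph P0 L0 inc) = app_iso f (with_proj G)"
    using pg unfolding is_plane_incidence_graph_def digraph_iso_def by blast
  have join0: "\<forall>p\<in>P0. \<forall>q\<in>P0. p \<noteq> q \<longrightarrow> (\<exists>!l. l \<in> L0 \<and> inc p l \<and> inc q l)"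
    and meet0: "\<forall>l\<in>L0. \<forall>m\<in>L0. l \<noteq> m \<longrightarrow> (\<exists>!p. p \<in> P0 \<and> inc p l \<and> inc p m)"
    and line0: "\<exists>l\<in>L0. card {p \<in> P0. inc p l} = n + 1"
    using plane unfolding finite_projective_plane_def by - (elim conjE, assumption)+
  let ?I = "incidence_graph P0 L0 inc"
  define h where "h = iso_verts f"
  have hV: "h ` pverts G = P0 <+> L0"
    using arg_cong[OF app, of verts] by (simp add: app_iso_def h_def incidence_graph_def)
  \<comment> \<open>The target is again a pair digraph, so its end maps are the projections; this
    forces the arc map to be the vertex map on both ends.\<close>
  have tail: "iso_tail f = fst" and head: "iso_head f = snd"
    using arg_cong[OF app, of tail] arg_cong[OF app, of head] by (simp_all add: app_iso_def)
  have inj: "inj_on h (pverts G)"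
    and ends: "\<And>a. a \<in> parcs G \<Longrightarrow> iso_arcs f a = (h (fst a), h (snd a))"
    using iso unfolding pre_digraph.digraph_isomorphism_def h_def
    by (auto simp: tail head prod_eq_iff)
  have arcs: "parcs ?I = iso_arcs f ` parcs G"
    using arg_cong[OF app, of arcs] by (simp add: app_iso_def)
  have adj: "(x, y) \<in> parcs G \<longleftrightarrow> (h x, h y) \<in> parcs ?I" if "x \<in> pverts G" "y \<in> pverts G" for x y
  proof
    show "(h x, h y) \<in> parcs ?I" if "(x, y) \<in> parcs G"
      using ends[OF that] that unfolding arcs by (metis fst_conv imageI snd_conv)
    assume "(h x, h y) \<in> parcs ?I"
    then obtain x' y' where a: "(x', y') \<in> parcs G" "(h x, h y) = iso_arcs f (x', y')"
      unfolding arcs by auto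
    then have "h x = h x'" "h y = h y'" using ends by auto
    moreover have "x' \<in> pverts G" "y' \<in> pverts G" using a in_arcsD1 in_arcsD2 by blast+
    ultimately show "(x, y) \<in> parcs G" using inj a that by (metis inj_onD)
  qed
  define k where "k = the_inv_into (pverts G) h"
  have hk: "h (k z) = z" "k z \<in> pverts G" if "z \<in> P0 <+> L0" for z
    using that f_the_inv_into_f[OF inj] the_inv_into_into[OF inj] hV unfolding k_def by auto
  have kh: "k (h x) = x" if "x \<in> pverts G" for x
    using that inj by (simp add: k_def the_inv_into_f_f)
  define P L where "P = (\<lambda>p. k (Inl p)) ` P0" and "L = (\<lambda>l. k (Inr l)) ` L0"
  have hP: "h (k (Inl p)) = Inl p" "k (Inl p) \<in> pverts G" if "p \<in> P0" for p
    using hk[of "Inl p"] that by auto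
  have hL: "h (k (Inr l)) = Inr l" "k (Inr l) \<in> pverts G" if "l \<in> L0" for l
    using hk[of "Inr l"] that by auto
  have V: "P \<union> L = pverts G"
  proof
    show "P \<union> L \<subseteq> pverts G" using hP hL by (auto simp: P_def L_def)
    show "pverts G \<subseteq> P \<union> L"
    proof
      fix x assume x: "x \<in> pverts G"
      then have "h x \<in> P0 <+> L0" using hV by blast
      then show "x \<in> P \<union> L" using kh[OF x] by (auto simp: P_def L_def image_iff)
    qed
  qed
  have disj: "P \<inter> L = {}"
  proof -
    have "k (Inl p) \<noteq> k (Inr l)" if "p \<in> P0" "l \<in> L0" for p l
      using hP(1)[OF that(1)] hL(1)[OF that(2)] by auto
    then show ?thesis by (auto simp: P_def L_def)
  qed
  have NP: "neighbours G (k (Inl p)) = (\<lambda>l. k (Inr l)) ` {l \<in> L0. inc p l}" if p: "p \<in> P0" for p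
  proof (rule Set.set_eqI)
    fix x
    show "x \<in> neighbours G (k (Inl p)) \<longleftrightarrow> x \<in> (\<lambda>l. k (Inr l)) ` {l \<in> L0. inc p l}"
    proof
      assume "x \<in> neighbours G (k (Inl p))"
      then have x: "x \<in> pverts G" "(k (Inl p), x) \<in> parcs G" using in_arcsD2 by auto
      then have "(Inl p, h x) \<in> parcs ?I" using adj[OF hP(2)[OF p] x(1)] hP(1)[OF p] by simp
      then obtain l where "h x = Inr l" "l \<in> L0" "inc p l" by (auto simp: incidence_graph_def)
      then show "x \<in> (\<lambda>l. k (Inr l)) ` {l \<in> L0. inc p l}" using kh[OF x(1)] by force
    next
      assume "x \<in> (\<lambda>l. k (Inr l)) ` {l \<in> L0. inc p l}"
      then obtain l where l: "x = k (Inr l)" "l \<in> L0" "inc p l" by blast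
      then show "x \<in> neighbours G (k (Inl p))"
        using adj[OF hP(2)[OF p] hL(2)[OF l(2)]] hP(1)[OF p] hL(1)[OF l(2)] p
        by (auto simp: incidence_graph_def)
    qed
  qed
  have NL: "neighbours G (k (Inr l)) = (\<lambda>p. k (Inl p)) ` {p \<in> P0. inc p l}" if l: "l \<in> L0" for l
  proof (rule Set.set_eqI)
    fix x
    show "x \<in> neighbours G (k (Inr l)) \<longleftrightarrow> x \<in> (\<lambda>p. k (Inl p)) ` {p \<in> P0. inc p l}"
    proof
      assume "x \<in> neighbours G (k (Inr l))"
      then have x: "x \<in> pverts G" "(k (Inr l), x) \<in> parcs G" using in_arcsD2 by auto
      then have "(Inr l, h x) \<in> parcs ?I" using adj[OF hL(2)[OF l] x(1)] hL(1)[OF l] by simp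
      then obtain p where "h x = Inl p" "p \<in> P0" "inc p l" by (auto simp: incidence_graph_def)
      then show "x \<in> (\<lambda>p. k (Inl p)) ` {p \<in> P0. inc p l}" using kh[OF x(1)] by force
    next
      assume "x \<in> (\<lambda>p. k (Inl p)) ` {p \<in> P0. inc p l}"
      then obtain p where p: "x = k (Inl p)" "p \<in> P0" "inc p l" by blast
      then show "x \<in> neighbours G (k (Inr l))"
        using adj[OF hL(2)[OF l] hP(2)[OF p(2)]] hP(1)[OF p(2)] hL(1)[OF l] l
        by (auto simp: incidence_graph_def)
    qed
  qed
  have injP: "inj_on (\<lambda>p. k (Inl p)) P0"
    by (rule inj_onI) (metis hP(1) sum.inject(1))
  have injL: "inj_on (\<lambda>l. k (Inr l)) L0"
    by (rule inj_onI) (metis hL(1) sum.inject(2))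
  have join: "card (neighbours G v \<inter> neighbours G w) = 1" if vw: "v \<in> P" "w \<in> P" "v \<noteq> w" for v w
  proof -
    obtain p q where pq: "p \<in> P0" "q \<in> P0" "v = k (Inl p)" "w = k (Inl q)" "p \<noteq> q"
      using vw unfolding P_def by blast
    have "\<exists>!l. l \<in> L0 \<and> inc p l \<and> inc q l"
      by (rule join0[rule_format]) (rule pq)+
    then obtain l where l: "{l \<in> L0. inc p l} \<inter> {l \<in> L0. inc q l} = {l}" by auto
    have "neighbours G v \<inter> neighbours G w
        = (\<lambda>l. k (Inr l)) ` ({l \<in> L0. inc p l} \<inter> {l \<in> L0. inc q l})"
      unfolding pq(3,4) NP[OF pq(1)] NP[OF pq(2)]
      by (rule inj_on_image_Int[OF injL, symmetric]) auto
    then show ?thesis unfolding l by simp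
  qed
  have meet: "card (neighbours G v \<inter> neighbours G w) = 1" if vw: "v \<in> L" "w \<in> L" "v \<noteq> w" for v w
  proof -
    obtain l m where lm: "l \<in> L0" "m \<in> L0" "v = k (Inr l)" "w = k (Inr m)" "l \<noteq> m"
      using vw unfolding L_def by blast
    have "\<exists>!p. p \<in> P0 \<and> inc p l \<and> inc p m"
      by (rule meet0[rule_format]) (rule lm)+
    then obtain p where p: "{p \<in> P0. inc p l} \<inter> {p \<in> P0. inc p m} = {p}" by auto
    have "neighbours G v \<inter> neighbours G w
        = (\<lambda>p. k (Inl p)) ` ({p \<in> P0. inc p l} \<inter> {p \<in> P0. inc p m})"
      unfolding lm(3,4) NL[OF lm(1)] NL[OF lm(2)]
      by (rule inj_on_image_Int[OF injP, symmetric]) auto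
    then show ?thesis unfolding p by simp
  qed
  obtain l where l: "l \<in> L0" "card {p \<in> P0. inc p l} = n + 1"
    using line0 by blast
  show thesis
  proof (rule that[of P L "k (Inr l)"])
    have "\<forall>v\<in>P. neighbours G v \<subseteq> L" using NP by (auto simp: P_def L_def)
    moreover have "\<forall>v\<in>L. neighbours G v \<subseteq> P" using NL by (auto simp: P_def L_def)
    ultimately show "plane_partition P L"
      unfolding plane_partition_def using V disj join meet by simp
    show "k (Inr l) \<in> L" using l by (simp add: L_def)
    have "card ((\<lambda>p. k (Inl p)) ` {p \<in> P0. inc p l}) = card {p \<in> P0. inc p l}"
      by (rule card_image, rule inj_on_subset[OF injP]) auto
    then show "card (neighbours G (k (Inr l))) = n + 1" using NL[OF l(1)] l(2) by simp
  qed
qed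

end

theorem theorem1p2:
  fixes d :: nat and G :: "'a pair_pre_digraph" and vs :: "'a list"
  assumes "d \<ge> 3"
    and "pair_graph G"
    and "Digraph_Component.connected (with_proj G)"
    and "card (pverts G) \<ge> 3"
    and "\<forall>v\<in>pverts G. out_degree (with_proj G) v \<ge> d"
    and "distinct vs" and "set vs = pverts G"
  shows "(MIN \<mu>\<in>spectrum (normalized_laplacian G vs). cmod (\<mu> - 1)) \<le> sqrt (real d - 1) / real d
    \<and> ((MIN \<mu>\<in>spectrum (normalized_laplacian G vs). cmod (\<mu> - 1)) = sqrt (real d - 1) / real d
        \<longleftrightarrow> is_plane_incidence_graph G (d - 1))"
proof -
  interpret pair_graph G by (rule assms(2))
  interpret M: min_degree_graph "pverts G" "neighbours G" d
    using assms by (intro min_degree_graph_neighbours) auto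
  let ?L = "normalized_laplacian G vs"
  define \<epsilon> where "\<epsilon> = sqrt (real d - 1) / real d"
  define m where "m = (MIN z\<in>spectrum ?L. cmod (z - 1))"
  have gap: "sqrt M.gap = \<epsilon>" by (simp add: M.gap_def \<epsilon>_def real_sqrt_divide)
  have fin: "finite (spectrum ?L)"
    by (rule card_finite_spectrum(1)[OF normalized_laplacian_carrier])
  have "vs \<noteq> []" using assms(7) M.V_nonempty by auto
  then have ne: "spectrum ?L \<noteq> {}"
    by (intro spectrum_non_empty[OF normalized_laplacian_carrier]) simp
  have pos: "0 < card (neighbours G v)" if "v \<in> pverts G" for v
    using M.deg_pos[OF that] by simp
  \<comment> \<open>The least Rayleigh quotient \<open>r\<close> produces a real eigenvalue
    \<open>c\<close> of D^-1 A at distance \<open>sqrt r\<close> from zero, hence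
    \<open>1 - c\<close> in the spectrum at that distance from one.\<close>
  obtain r g v where form: "\<And>h. 0 \<le> M.form r h" and g: "M.form r g = 0" "v \<in> pverts G" "g v \<noteq> 0"
    using M.rayleigh_minimizer[OF M.V_nonempty] by metis
  obtain c f u where c: "\<bar>c\<bar> = sqrt r" and u: "u \<in> pverts G" "f u \<noteq> 0"
    and ev: "\<And>x. x \<in> pverts G \<Longrightarrow> M.nsum f x = c * real (card (neighbours G x)) * f x"
    using M.rayleigh_eigenvalue[OF form g] by metis
  have "1 - complex_of_real c \<in> spectrum ?L"
  proof (rule normalized_laplacian_eigenvalueI[OF assms(6,7) u(1), of "\<lambda>x. complex_of_real (f x)"])
    fix x assume "x \<in> pverts G"
    from arg_cong[OF ev[OF this], of complex_of_real]
    show "(\<Sum>w\<in>neighbours G x. complex_of_real (f w))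
        = complex_of_real c * of_nat (card (neighbours G x)) * complex_of_real (f x)"
      by (simp add: M.nsum_def)
  qed (use u pos in auto)
  then have "m \<le> cmod (1 - complex_of_real c - 1)"
    unfolding m_def using fin by (intro Min_le finite_imageI imageI)
  then have m_le: "m \<le> sqrt r" by (simp add: c)
  have r_le: "r \<le> M.gap" by (rule M.form_nonneg_le_gap[OF form])
  have bound: "m \<le> \<epsilon>" using m_le real_sqrt_le_mono[OF r_le] gap by simp
  have "is_plane_incidence_graph G (d - 1)" if "m = \<epsilon>"
  proof -
    \<comment> \<open>In the chain \<open>m \<le> sqrt r \<le> sqrt M.gap = \<epsilon>\<close>
      equality of the ends forces \<open>r = M.gap\<close>, which makes the structural results
      available.\<close>
    have "sqrt M.gap \<le> sqrt r" using m_le that gap by simp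
    then have "r = M.gap" using r_le by simp
    then have nonneg: "0 \<le> M.form M.gap h" for h using form by simp
    obtain P L where pl: "M.plane_partition P L"
      using M.plane_partition_of_form_nonneg[OF nonneg] by metis
    have "finite_projective_plane P L (\<lambda>p l. l \<in> neighbours G p) (d - 1)"
      using M.plane_partition_projective_plane[OF pl M.regular[OF nonneg] assms(1) M.V_nonempty] .
    moreover have "digraph_iso (with_proj G)
        (with_proj (incidence_graph P L (\<lambda>p l. l \<in> neighbours G p)))"
      using pl unfolding M.plane_partition_def by (intro digraph_iso_incidence_graph) auto
    ultimately show ?thesis by (rule is_plane_incidence_graphI)
  qed
  \<comment> \<open>The upper bound being known, it remains to keep every eigenvalue at distance at
    least \<open>\<epsilon>\<close> from one. Degrees of at least three and the line with
    \<open>d\<close> points make the graph regular, as \<open>plane_partition_eigenvalue\<close>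
    requires.\<close>
  moreover have "m = \<epsilon>" if plane: "is_plane_incidence_graph G (d - 1)"
  proof (rule antisym[OF bound])
    obtain P L l where pl: "M.plane_partition P L" and l: "l \<in> L" "card (neighbours G l) = d - 1 + 1"
      using incidence_graph_iso_partition[OF M.neighbourhood_graph_axioms plane] by metis
    have reg: "card (neighbours G x) = d" if "x \<in> pverts G" for x
    proof (rule M.plane_partition_regular[OF pl l(1) _ _ that])
      show "card (neighbours G l) = d" using l(2) assms(1) by simp
      show "3 \<le> card (neighbours G x)" if "x \<in> pverts G" for x
        using M.min_degree[OF that] assms(1) by simp
    qed
    have "\<epsilon> \<le> cmod (z - 1)" if z: "z \<in> spectrum ?L" for z
    proof -
      obtain f u where u: "u \<in> pverts G" "f u \<noteq> 0" and ev: "\<And>x. x \<in> pverts G \<Longrightarrow>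
          (\<Sum>w\<in>neighbours G x. f w) = of_nat (card (neighbours G x)) * (1 - z) * f x"
        using normalized_laplacian_eigenvalueE[OF assms(6,7) pos z] by metis
      have "\<epsilon> \<le> cmod (1 - z)" unfolding \<epsilon>_def
        by (rule M.plane_partition_eigenvalue[where f = f, OF pl reg _ u]) (use ev reg assms(1) in auto)
      then show ?thesis by (simp add: norm_minus_commute)
    qed
    then show "\<epsilon> \<le> m" unfolding m_def using fin ne by (subst Min_ge_iff) auto
  qed
  ultimately show ?thesis using bound unfolding m_def \<epsilon>_def by blast
qed

end
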